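(* Let $\Bbbk$ be a field of characteristic $p\ge 3$, let $T$ be an index set, and let $A=\Bbbk[x_i\mid i\in T]$ be a polynomial algebra equipped with a Poisson bracket $\{-,-\}$ making it a Poisson algebra. Suppose that for each $i\in T$ there exists $\gamma(x_i)\in A$ such that $\mathrm{ad}_{x_i}^p=\mathrm{ad}_{\gamma(x_i)}$. Then $A$ admits a restricted Poisson structure $(-)^{\{p\}}:A\to A$ such that $x_i^{\{p\}}=\gamma(x_i)$ for all $i\in T$.
   Context: All algebras are over $\Bbbk$, of characteristic $p\ge 3$. A Poisson algebra is a commutative associative algebra $A$ with a Lie bracket $\{-,-\}$ satisfying $\{xy,z\}=x\{y,z\}+y\{x,z\}$; write $\mathrm{ad}_x(y)=\{x,y\}$. A restricted Lie algebra is a Lie algebra $L$ with a map ($p$-map) $x\mapsto x^{[p]}$ such that: (1) $\mathrm{ad}_x^p=\mathrm{ad}_{x^{[p]}}$; (2) $(\lambda x)^{[p]}=\lambda^p x^{[p]}$ for $\lambda\in\Bbbk$; (3) $(x+y)^{[p]}=x^{[p]}+y^{[p]}+\Lambda_p(x,y)$, where $\Lambda_p(x,y)=\sum_{i=1}^{p-1}\frac{s_i(x,y)}{i}$ and $s_i(x,y)$ is the coefficient of $t^{i-1}$ in the formal expression $\mathrm{ad}_{tx+y}^{p-1}(x)$. A restricted Poisson structure on a Poisson algebra $A$ is a map $(-)^{\{p\}}:A\to A$ such that $(A,\{-,-\},(-)^{\{p\}})$ is a restricted Lie algebra and $(x^2)^{\{p\}}=2x^p x^{\{p\}}$ for all $x\in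 A$. *)

theory Defs
  imports
    "HOL-Library.Poly_Mapping"
    "HOL-Computational_Algebra.Computational_Algebra"
begin

text \<open>
  Algebraic structures live on a carrier inside an ambient type. Brackets and p-maps are
  total functions on the ambient type, but are only constrained on the carrier.
\<close>

locale lie_algebra = vector_space scale
  for scale :: "'k::field \<Rightarrow> 'a::ab_group_add \<Rightarrow> 'a" +
  fixes L :: "'a set" and br :: "'a \<Rightarrow> 'a \<Rightarrow> 'a"
  assumes carrier_subspace: "subspace L"
    and br_closed: "\<lbrakk>x \<in> L; y \<in> L\<rbrakk> \<Longrightarrow> br x y \<in> L"
    and br_add_left: "\<lbrakk>x \<in> L; y \<in> L; z \<in> L\<rbrakk> \<Longrightarrow> br (x + y) z = br x z + br y z"
    and br_add_right: "\<lbrakk>x \<in> L; y \<in> L; z \<in> L\<rbrakk> \<Longrightarrow> br x (y + z) = br x y + br x z"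
    and br_scale_left: "\<lbrakk>x \<in> L; y \<in> L\<rbrakk> \<Longrightarrow> br (scale c x) y = scale c (br x y)"
    and br_scale_right: "\<lbrakk>x \<in> L; y \<in> L\<rbrakk> \<Longrightarrow> br x (scale c y) = scale c (br x y)"
    and br_self: "x \<in> L \<Longrightarrow> br x x = 0"
    and jacobi: "\<lbrakk>x \<in> L; y \<in> L; z \<in> L\<rbrakk> \<Longrightarrow>
      br x (br y z) + br y (br z x) + br z (br x y) = 0"

text \<open>The coefficientwise extension of a bracket on \<open>L\<close> to \<open>L[t]\<close>, with \<open>t\<close> central.\<close>

definition poly_br :: "('a::ab_group_add \<Rightarrow> 'a \<Rightarrow> 'a) \<Rightarrow> 'a poly \<Rightarrow> 'a poly \<Rightarrow> 'a poly" where
  "poly_br br f g =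
     (\<Sum>i\<le>degree f. \<Sum>j\<le>degree g. monom (br (coeff f i) (coeff g j)) (i + j))"

text \<open>\<open>[:y, x:]\<close> is \<open>tx + y\<close>.\<close>

definition jacobson_s :: "('a::ab_group_add \<Rightarrow> 'a \<Rightarrow> 'a) \<Rightarrow> nat \<Rightarrow> nat \<Rightarrow> 'a \<Rightarrow> 'a \<Rightarrow> 'a" where
  "jacobson_s br p i x y = coeff ((poly_br br [:y, x:] ^^ (p - 1)) [:x:]) (i - 1)"

definition jacobson_Lambda ::
  "('k::field \<Rightarrow> 'a::ab_group_add \<Rightarrow> 'a) \<Rightarrow> ('a \<Rightarrow> 'a \<Rightarrow> 'a) \<Rightarrow> nat \<Rightarrow> 'a \<Rightarrow> 'a \<Rightarrow> 'a" where
  "jacobson_Lambda scale br p x y =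
     (\<Sum>i = 1..p - 1. scale (1 / of_nat i) (jacobson_s br p i x y))"

locale restricted_lie_algebra = lie_algebra scale L br
  for scale :: "'k::field \<Rightarrow> 'a::ab_group_add \<Rightarrow> 'a" and L br +
  fixes p :: nat and pmap :: "'a \<Rightarrow> 'a"
  assumes char_eq: "CHAR('k) = p" and char_ge: "p \<ge> 3"
    and pmap_closed: "x \<in> L \<Longrightarrow> pmap x \<in> L"
    and pmap_ad: "\<lbrakk>x \<in> L; y \<in> L\<rbrakk> \<Longrightarrow> (br x ^^ p) y = br (pmap x) y"
    and pmap_scale: "x \<in> L \<Longrightarrow> pmap (scale c x) = scale (c ^ p) (pmap x)"
    and pmap_add: "\<lbrakk>x \<in> L; y \<in> L\<rbrakk> \<Longrightarrow>
      pmap (x + y) = pmap x + pmap y + jacobson_Lambda scale br p x y"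

locale poisson_algebra = lie_algebra scale A br
  for scale :: "'k::field \<Rightarrow> 'a::comm_ring_1 \<Rightarrow> 'a" and A br +
  assumes one_closed: "1 \<in> A"
    and mult_closed: "\<lbrakk>x \<in> A; y \<in> A\<rbrakk> \<Longrightarrow> x * y \<in> A"
    and scale_mult: "\<lbrakk>x \<in> A; y \<in> A\<rbrakk> \<Longrightarrow> scale c (x * y) = scale c x * y"
    and leibniz: "\<lbrakk>x \<in> A; y \<in> A; z \<in> A\<rbrakk> \<Longrightarrow> br (x * y) z = x * br y z + y * br x z"

locale restricted_poisson_algebra =
  poisson_algebra scale A br + restricted_lie_algebra scale A br p pmap
  for scale :: "'k::field \<Rightarrow> 'a::comm_ring_1 \<Rightarrow> 'a" and A br p pmap +
  assumes pmap_square: "x \<in> A \<Longrightarrow> pmap (x ^ 2) = 2 * x ^ p * pmap x"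

text \<open>
  Multivariate polynomials are finitely supported maps from exponent vectors (themselves
  finitely supported) to coefficients. The carrier \<open>mpolys T\<close> of \<open>k[x_i | i \<in> T]\<close> consists of
  the polynomials all of whose monomials only involve variables indexed by \<open>T\<close>;
  in particular \<open>T\<close> may be empty.
\<close>

type_synonym ('i, 'k) mpol = "('i \<Rightarrow>\<^sub>0 nat) \<Rightarrow>\<^sub>0 'k"

definition mpoly_scale :: "'k::field \<Rightarrow> ('i, 'k) mpol \<Rightarrow> ('i, 'k) mpol" where
  "mpoly_scale c f = Poly_Mapping.single 0 c * f"

definition mpoly_var :: "'i \<Rightarrow> ('i, 'k::field) mpol" where
  "mpoly_var i = Poly_Mapping.single (Poly_Mapping.single i 1) 1"

definition mpolys :: "'i set \<Rightarrow> ('i, 'k::field) mpol set" where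
  "mpolys T = {f. \<forall>m \<in> Poly_Mapping.keys f. Poly_Mapping.keys m \<subseteq> T}"

end

theory Submission
  imports Defs "HOL-Number_Theory.Cong"
begin

text \<open>
  Put \<open>alpha w v = ad_w^(p-1) v\<close>. In characteristic \<open>p\<close> this is the formal derivative of
  \<open>w \<mapsto> w^[p]\<close> in the direction \<open>v\<close>, so that a p-map is a primitive of \<open>alpha\<close>, and Jacobson's
  \<open>Lambda x y\<close> is what comes from integrating along \<open>t \<mapsto> tx + y\<close>: the derivative in \<open>t\<close> of
  \<open>Lambda (tx) y\<close> is \<open>alpha (tx + y) x\<close>, and \<open>Lambda (tx) y\<close> has no terms of degree \<open>0\<close> or \<open>p\<close>.
  The identities for p-th powers, usually read off in an enveloping algebra with the help of the
  Poincare-Birkhoff-Witt theorem, are proved here by differentiation: two polynomials of degree at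
  most \<open>p\<close> with the same derivative differ only in the degrees \<open>0\<close> and \<open>p\<close>, where they can be
  compared by hand. The one-form \<open>alpha\<close> is closed (\<open>alpha_closed\<close>), and therefore \<open>Lambda\<close> is a
  symmetric cocycle (\<open>Lambda_cocycle\<close>, \<open>Lambda_commute\<close>).

  A p-map on a Lie algebra can be prescribed on a basis, but a basis of \<open>A\<close> does not see the
  multiplication. The remedy is to pass to first-order jets. Let \<open>J\<close> be the free \<open>A\<close>-module with one
  basis element for each variable and one more, \<open>c\<close>. There is an injective additive map
  \<open>jet : A \<rightarrow> J\<close> that sends the variables to their basis elements and \<open>1\<close> to \<open>c\<close>, such that
  \<open>jet (f g) = f jet g + g jet f - f g c\<close>. The Poisson bracket makes \<open>J\<close> a Lie-Rinehart algebra over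
  \<open>A\<close>, in which \<open>jet f\<close> acts on \<open>A\<close> as \<open>{f, -}\<close> and \<open>[jet f, jet g] = jet {f, g}\<close>.

  On a Lie-Rinehart algebra the p-map should obey the two rules
  \<open>P (u + v) = P u + P v + Lambda u v\<close> and \<open>P (a u) = a^p P u + (a u)^(p-1)(a) u\<close>, the latter being
  Hochschild's formula. They are compatible (\<open>hochschild_add_left\<close>, \<open>hochschild_add_right\<close>,
  \<open>hochschild_mult\<close>), so that on a free module \<open>P\<close> may be prescribed on the basis. Take
  \<open>P (jet x_i) = jet (\<gamma> x_i)\<close> and \<open>P c = 0\<close>.

  It remains to see that \<open>P\<close> maps \<open>jet A\<close> to itself. The elements \<open>f\<close> with \<open>P (jet f)\<close> in \<open>jet A\<close>
  contain the variables and are closed under sums, because \<open>jet\<close> preserves brackets. They are closed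
  under squares: in \<open>jet (f^2) = 2 f jet f - f^2 c\<close> the two summands commute and \<open>f\<close> is killed by
  \<open>{f, -}\<close>, whence \<open>P (jet (f^2)) = 2 f^p P (jet f)\<close>; if \<open>P (jet f) = jet g\<close>, this equals
  \<open>jet (2 f^p g)\<close>, since \<open>jet (f^p) = f^p c\<close> (\<open>extended_pmap_jet_square\<close>). As \<open>p\<close> is odd, squares
  and sums give products, so every \<open>f\<close> qualifies. The p-map induced on \<open>A\<close> is restricted Poisson,
  the rule for squares being the one just seen.
\<close>

section \<open>Binomial sums modulo p\<close>

lemma additive_funpow:
  fixes D :: "'b::ab_group_add \<Rightarrow> 'b"
  assumes "additive D" shows "additive (D ^^ n)"
proof (induction n)
  case 0
  show ?case by unfold_locales simp
next
  case (Suc n)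
  then show ?case using assms by (simp add: additive_def)
qed

lemma (in module) additive_scale_of_nat:
  assumes "additive D"
  shows "D (of_nat n *s x) = of_nat n *s D x"
proof (induction n)
  case 0
  show ?case using additive.zero[OF assms] by simp
next
  case (Suc n)
  then show ?case using additive.add[OF assms] by (simp add: scale_left_distrib)
qed

text \<open>
  Think of \<open>Z i j\<close> as \<open>b (D^i x) (D^j y)\<close> for a bilinear pairing \<open>b\<close> that satisfies the Leibniz rule
  for \<open>D\<close>. The left-hand side arises when a derivation is moved past the \<open>n\<close>-th power of an operator.
\<close>

lemma (in module) pairing_expansion:
  fixes Z :: "nat \<Rightarrow> nat \<Rightarrow> 'b"
  assumes D: "additive D"
    and Z: "\<And>i j. D (Z i j) = Z (Suc i) j + Z i (Suc j)"
  shows "(\<Sum>j<n. (D ^^ j) (Z 0 (n - Suc j))) =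
         (\<Sum>l<n. of_nat (n choose Suc l) *s Z l (n - Suc l))"
proof (induction n)
  case 0
  show ?case by simp
next
  case (Suc n)
  have "(\<Sum>j<Suc n. (D ^^ j) (Z 0 (Suc n - Suc j)))
      = Z 0 n + (\<Sum>j<n. D ((D ^^ j) (Z 0 (n - Suc j))))"
    by (simp add: sum.lessThan_Suc_shift del: sum.lessThan_Suc)
  also have "(\<Sum>j<n. D ((D ^^ j) (Z 0 (n - Suc j))))
      = D (\<Sum>j<n. (D ^^ j) (Z 0 (n - Suc j)))"
    by (simp add: additive.sum[OF D])
  also have "\<dots> = (\<Sum>l<n. of_nat (n choose Suc l) *s (Z (Suc l) (n - Suc l) + Z l (n - l)))"
    unfolding Suc.IH
    by (auto simp: additive.sum[OF D] additive_scale_of_nat[OF D] Z Suc_diff_Suc intro!: sum.cong)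
  also have "\<dots> = (\<Sum>l<n. of_nat (n choose Suc l) *s Z (Suc l) (n - Suc l)) +
      (\<Sum>l<n. of_nat (n choose Suc l) *s Z l (n - l))"
    by (simp add: scale_right_distrib sum.distrib)
  also have "Z 0 n + \<dots> = (\<Sum>l<Suc n. of_nat (n choose l) *s Z l (n - l)) +
      (\<Sum>l<Suc n. of_nat (n choose Suc l) *s Z l (n - l))"
    by (subst sum.lessThan_Suc_shift) (simp add: ac_simps binomial_eq_0)
  also have "\<dots> = (\<Sum>l<Suc n. of_nat (Suc n choose Suc l) *s Z l (Suc n - Suc l))"
    by (simp only: sum.distrib[symmetric] scale_left_distrib[symmetric]
        of_nat_add[symmetric] binomial_Suc_Suc diff_Suc_Suc)
  finally show ?case .
qed

lemma module_mult: "module ((*) :: 'a::comm_ring_1 \<Rightarrow> 'a \<Rightarrow> 'a)"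
  by unfold_locales (auto simp: algebra_simps)

text \<open>
  The primality of \<open>p\<close> together with \<open>p = 0\<close> is a condition that passes from a ring to its polynomial
  rings and to its algebras.
\<close>

locale char_p =
  fixes p :: nat and ty :: "'a::comm_ring_1 itself"
  assumes p_prime: "prime p" and p_zero: "(of_nat p :: 'a) = 0"
begin

lemma of_nat_dvd_p: "p dvd n \<Longrightarrow> (of_nat n :: 'a) = 0"
  using p_zero by (auto elim!: dvdE)

lemma of_nat_choose_p: "0 < k \<Longrightarrow> k < p \<Longrightarrow> (of_nat (p choose k) :: 'a) = 0"
  by (rule of_nat_dvd_p) (use p_prime in \<open>auto intro: dvd_choose_prime\<close>)

lemma of_nat_inverse:
  assumes "coprime n p" shows "\<exists>b. (of_nat n :: 'a) * b = 1"
proof -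
  from assms obtain m where "[n * m = 1] (mod p)"
    using cong_solve_coprime_nat by auto
  then have "(of_nat (n * m) :: 'a) = of_nat 1"
    using prime_gt_1_nat[OF p_prime] p_zero
    by (metis cong_def mod_mult_div_eq of_nat_add of_nat_mult mult_zero_left add_0_right)
  then show ?thesis by auto
qed

lemma of_nat_fact_inverse: "k < p \<Longrightarrow> \<exists>b. (of_nat (fact k) :: 'a) * b = 1"
  by (rule of_nat_inverse)
    (metis coprime_commute p_prime prime_imp_coprime prime_dvd_fact_iff not_le)

lemma of_nat_less_inverse: "0 < k \<Longrightarrow> k < p \<Longrightarrow> \<exists>b. (of_nat k :: 'a) * b = 1"
  by (rule of_nat_inverse)
    (metis coprime_commute p_prime prime_imp_coprime nat_dvd_not_less)

end

section \<open>Hochschild's formula\<close>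

definition derivation :: "('a::comm_ring_1 \<Rightarrow> 'a) \<Rightarrow> bool" where
  "derivation D \<longleftrightarrow> additive D \<and> (\<forall>f g. D (f * g) = f * D g + g * D f)"

lemma derivationD:
  assumes "derivation D"
  shows "D (f + g) = D f + D g" "D (f * g) = f * D g + g * D f" "D 0 = 0" "D 1 = 0"
    "additive D" "D (of_nat n) = 0" "D (sum h X) = (\<Sum>x\<in>X. D (h x))"
proof -
  show *: "additive D" "D (f * g) = f * D g + g * D f"
    using assms by (auto simp: derivation_def)
  show **: "D (f + g) = D f + D g" for f g using * by (auto simp: additive_def)
  show z: "D 0 = 0" by (rule additive.zero[OF *(1)])
  have "D (1 * 1) = 1 * D 1 + 1 * D 1" using assms unfolding derivation_def by blast
  then show one: "D 1 = 0" by simp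
  show "D (of_nat n) = 0" by (induction n) (simp_all add: ** one z)
  show "D (sum h X) = (\<Sum>x\<in>X. D (h x))" by (rule additive.sum[OF *(1)])
qed

lemma derivation_mult_left: "derivation D \<Longrightarrow> derivation (\<lambda>g. a * D g)"
  by (auto simp: derivation_def additive_def algebra_simps)

text \<open>
  These are the partial Bell polynomials in \<open>E^0 a, E^1 a, E^2 a, \<dots>\<close> for \<open>E = a D\<close>: the coefficients
  in \<open>(a D)^n = (\<Sum>k. bell D a n k D^k)\<close>.
\<close>

fun bell :: "('a::comm_ring_1 \<Rightarrow> 'a) \<Rightarrow> 'a \<Rightarrow> nat \<Rightarrow> nat \<Rightarrow> 'a" where
  "bell D a 0 k = (if k = 0 then 1 else 0)"
| "bell D a (Suc n) 0 = 0"
| "bell D a (Suc n) (Suc k) = a * D (bell D a n (Suc k)) + a * bell D a n k"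

text \<open>
  The coefficient sums for \<open>k!\<close> times the Bell polynomials; unlike the Bell polynomials themselves,
  they display binomial coefficients that vanish modulo \<open>p\<close>.
\<close>

fun fact_bell :: "('a::comm_ring_1 \<Rightarrow> 'a) \<Rightarrow> 'a \<Rightarrow> nat \<Rightarrow> nat \<Rightarrow> 'a" where
  "fact_bell D a n 0 = (if n = 0 then 1 else 0)"
| "fact_bell D a n (Suc k) =
     (\<Sum>j<n. of_nat (n choose Suc j) * ((\<lambda>g. a * D g) ^^ j) a * fact_bell D a (n - Suc j) k)"

lemma bell_eq_0: "derivation D \<Longrightarrow> n < k \<Longrightarrow> bell D a n k = 0"
proof (induction n arbitrary: k)
  case (Suc n)
  then show ?case by (cases k) (simp_all add: derivationD)
qed simp

lemma bell_diag: "derivation D \<Longrightarrow> bell D a n n = a ^ n"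
  by (induction n) (simp_all add: bell_eq_0 derivationD)

lemma bell_1: "derivation D \<Longrightarrow> bell D a (Suc n) (Suc 0) = ((\<lambda>g. a * D g) ^^ n) a"
  by (induction n) (simp_all add: derivationD)

text \<open>
  The recursion of the Bell polynomials multiplied by \<open>k!\<close>. It comes from Pascal's rule and the
  Leibniz rule.
\<close>

lemma fact_bell_rec:
  assumes D: "derivation D"
  shows "fact_bell D a (Suc n) k =
    a * D (fact_bell D a n k) + of_nat k * a * fact_bell D a n (k - 1)"
proof (induction k arbitrary: n)
  case 0
  show ?case using derivationD[OF D] by simp
next
  case (Suc k)
  let ?x = "\<lambda>j. ((\<lambda>g. a * D g) ^^ j) a" and ?W = "fact_bell D a"
  have E: "a * D (?W m k) = ?W (Suc m) k - of_nat k * a * ?W m (k - 1)" for m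
    by (simp add: Suc.IH)
  have k: "(\<Sum>j<n. of_nat (n choose Suc j) * ?x j * (of_nat k * a * ?W (n - Suc j) (k - 1)))
      = of_nat k * a * ?W n k"
  proof (cases k)
    case (Suc k')
    then show ?thesis by (auto simp: sum_distrib_left intro!: sum.cong)
  qed simp
  have "a * D (?W n (Suc k)) = (\<Sum>j<n. of_nat (n choose Suc j) *
      (?x (Suc j) * ?W (n - Suc j) k + ?x j * (a * D (?W (n - Suc j) k))))"
    by (simp add: sum_distrib_left algebra_simps derivationD[OF D])
  also have "\<dots> = (\<Sum>j<n. of_nat (n choose Suc j) * ?x (Suc j) * ?W (n - Suc j) k) +
      (\<Sum>j<n. of_nat (n choose Suc j) * ?x j * ?W (n - j) k) -
      (\<Sum>j<n. of_nat (n choose Suc j) * ?x j * (of_nat k * a * ?W (n - Suc j) (k - 1)))"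
    unfolding E sum.distrib[symmetric] sum_subtractf[symmetric]
    by (auto simp: algebra_simps Suc_diff_Suc intro!: sum.cong)
  also have "\<dots> = (\<Sum>j<n. of_nat (n choose Suc j) * ?x (Suc j) * ?W (n - Suc j) k) +
      (\<Sum>j<n. of_nat (n choose Suc j) * ?x j * ?W (n - j) k) - of_nat k * a * ?W n k"
    by (simp only: k)
  finally have 1: "a * D (?W n (Suc k)) = \<dots>" .
  have "?W (Suc n) (Suc k) = (\<Sum>j<Suc n. of_nat (n choose j) * ?x j * ?W (n - j) k) +
      (\<Sum>j<Suc n. of_nat (n choose Suc j) * ?x j * ?W (n - j) k)"
    by (simp only: fact_bell.simps binomial_Suc_Suc of_nat_add distrib_right sum.distrib diff_Suc_Suc)
  also have "(\<Sum>j<Suc n. of_nat (n choose j) * ?x j * ?W (n - j) k) =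
      a * ?W n k + (\<Sum>j<n. of_nat (n choose Suc j) * ?x (Suc j) * ?W (n - Suc j) k)"
    by (subst sum.lessThan_Suc_shift) simp
  also have "(\<Sum>j<Suc n. of_nat (n choose Suc j) * ?x j * ?W (n - j) k) =
      (\<Sum>j<n. of_nat (n choose Suc j) * ?x j * ?W (n - j) k)"
    by (simp add: binomial_eq_0)
  finally show ?case unfolding 1 by (simp add: algebra_simps del: fact_bell.simps)
qed

lemma fact_bell:
  assumes D: "derivation D"
  shows "of_nat (fact k) * bell D a n k = fact_bell D a n k"
proof (induction n arbitrary: k)
  case 0
  show ?case by (cases k) simp_all
next
  case (Suc n)
  show ?case
  proof (cases k)
    case 0
    then show ?thesis by simp
  next
    case (Suc l)
    have 1: "of_nat (fact (Suc l)) * D (bell D a n (Suc l)) = D (fact_bell D a n (Suc l))"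
      using module.additive_scale_of_nat[OF module_mult derivationD(5)[OF D], of "fact (Suc l)" "bell D a n (Suc l)"]
      unfolding Suc.IH by (rule sym)
    have 2: "of_nat (fact (Suc l)) * bell D a n l = of_nat (Suc l) * fact_bell D a n l"
      using Suc.IH[of l] by (simp add: algebra_simps del: fact_bell.simps bell.simps)
    have 3: "F * (a * X + a * Y) = a * (F * X) + a * (F * Y)" for F X Y :: 'a
      by (simp add: algebra_simps)
    show ?thesis
      unfolding Suc fact_bell_rec[OF D] bell.simps 3 1 2 by (simp only: diff_Suc_1 mult_ac)
  qed
qed

text \<open>
  In \<open>k!\<close> times the polynomial every summand carries a factor \<open>p choose j\<close> with \<open>0 < j < p\<close>, and
  \<open>k!\<close> is invertible.
\<close>

lemma (in char_p) bell_p_eq_0: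
  fixes D :: "'a \<Rightarrow> 'a"
  assumes D: "derivation D" and k: "1 < k" "k < p"
  shows "bell D a p k = 0"
proof -
  obtain l where l: "k = Suc l" "l > 0" using k by (cases k) auto
  have "fact_bell D a p k = 0"
    unfolding l fact_bell.simps
  proof (rule sum.neutral, safe)
    fix j assume j: "j < p"
    show "of_nat (p choose Suc j) * ((\<lambda>g. a * D g) ^^ j) a * fact_bell D a (p - Suc j) l = 0"
    proof (cases "Suc j = p")
      case True
      then show ?thesis using l by (cases l) auto
    next
      case False
      then show ?thesis using of_nat_choose_p[of "Suc j"] j by simp
    qed
  qed
  then have "of_nat (fact k) * bell D a p k = 0" by (simp add: fact_bell[OF D])
  moreover obtain b where b: "(of_nat (fact k) :: 'a) * b = 1"
    using of_nat_fact_inverse[OF k(2)] by blast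
  ultimately have "b * (of_nat (fact k) * bell D a p k) = 0" by simp
  moreover have "b * (of_nat (fact k) * bell D a p k) = (of_nat (fact k) * b) * bell D a p k"
    by (simp only: mult_ac)
  ultimately show ?thesis unfolding b by simp
qed

locale char_p_module = module scale + char_p p "TYPE('a)"
  for scale :: "'a::comm_ring_1 \<Rightarrow> 'b::ab_group_add \<Rightarrow> 'b" (infixr "*s" 75) and p :: nat
begin

text \<open>
  The coefficients of the expansions of the two sums are neighbours in row \<open>p - 1\<close> of Pascal's triangle,
  so they add up to binomial coefficients \<open>p choose l\<close> with \<open>0 < l < p\<close>.
\<close>

lemma pairing_antisymmetry:
  fixes Z :: "nat \<Rightarrow> nat \<Rightarrow> 'b"
  assumes D: "additive D"
    and Z: "\<And>i j. D (Z i j) = Z (Suc i) j + Z i (Suc j)"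
  shows "(\<Sum>j<p - 1. (D ^^ j) (Z 0 (p - 2 - j))) = - (\<Sum>j<p - 1. (D ^^ j) (Z (p - 2 - j) 0))"
proof -
  let ?n = "p - 1"
  have p: "p = Suc ?n" using prime_gt_0_nat[OF p_prime] by simp
  have pc: "p choose Suc l = (?n choose l) + (?n choose Suc l)" for l
    using binomial_Suc_Suc[of ?n l] p by simp
  have "(\<Sum>j<?n. (D ^^ j) (Z 0 (?n - Suc j))) + (\<Sum>j<?n. (D ^^ j) (Z (?n - Suc j) 0)) =
     (\<Sum>l<?n. of_nat (?n choose Suc l) *s Z l (?n - Suc l)) +
     (\<Sum>l<?n. of_nat (?n choose Suc l) *s Z (?n - Suc l) l)"
    using pairing_expansion[where Z=Z, OF D Z, of ?n] pairing_expansion[OF D, of "\<lambda>i j. Z j i" ?n] Z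
    by (simp add: add.commute)
  also have "(\<Sum>l<?n. of_nat (?n choose Suc l) *s Z (?n - Suc l) l) =
      (\<Sum>l<?n. of_nat (?n choose l) *s Z l (?n - Suc l))"
    unfolding sum.nat_diff_reindex[of "\<lambda>l. of_nat (?n choose l) *s Z l (?n - Suc l)", symmetric]
  proof (rule sum.cong)
    fix l assume "l \<in> {..<?n}"
    then have l: "l < ?n" by simp
    then show "of_nat (?n choose Suc l) *s Z (?n - Suc l) l =
        of_nat (?n choose (?n - Suc l)) *s Z (?n - Suc l) (?n - Suc (?n - Suc l))"
      using binomial_symmetric[of "Suc l" ?n] by (simp add: Suc_diff_Suc)
  qed simp
  also have "(\<Sum>l<?n. of_nat (?n choose Suc l) *s Z l (?n - Suc l)) + \<dots> =
     (\<Sum>l<?n. of_nat (p choose Suc l) *s Z l (?n - Suc l))"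
    unfolding pc of_nat_add scale_left_distrib sum.distrib by (rule add.commute)
  also have "\<dots> = 0"
    by (intro sum.neutral) (auto simp: of_nat_choose_p)
  finally show ?thesis by (simp add: eq_neg_iff_add_eq_0 numeral_2_eq_2)
qed

text \<open>
  Only the last coefficient \<open>p choose p\<close> of the expansion survives.
\<close>

lemma pairing_full:
  fixes Z :: "nat \<Rightarrow> nat \<Rightarrow> 'b"
  assumes D: "additive D"
    and Z: "\<And>i j. D (Z i j) = Z (Suc i) j + Z i (Suc j)"
  shows "(\<Sum>j<p. (D ^^ j) (Z 0 (p - 1 - j))) = Z (p - 1) 0"
proof -
  obtain n where p: "p = Suc n" using prime_gt_0_nat[OF p_prime] by (cases p) auto
  have "(\<Sum>j<p. (D ^^ j) (Z 0 (p - Suc j))) = (\<Sum>l<Suc n. of_nat (p choose Suc l) *s Z l (p - Suc l))"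
    unfolding p[symmetric] by (rule pairing_expansion[where Z=Z, OF D Z])
  also have "\<dots> = (\<Sum>l<n. of_nat (p choose Suc l) *s Z l (p - Suc l)) + Z n 0"
    by (simp add: p binomial_eq_0)
  also have "(\<Sum>l<n. of_nat (p choose Suc l) *s Z l (p - Suc l)) = 0"
  proof (intro sum.neutral ballI)
    fix l assume "l \<in> {..<n}"
    then have "(of_nat (p choose Suc l) :: 'a) = 0"
      by (intro of_nat_choose_p) (simp_all add: p)
    then show "of_nat (p choose Suc l) *s Z l (p - Suc l) = 0" by simp
  qed
  finally show ?thesis by (simp add: p)
qed

text \<open>
  Hochschild's formula \<open>(a D)^p = a^p D^p + (a D)^(p-1)(a) D\<close>, with one factor \<open>D\<close> cancelled on the
  right and for a connection \<open>\<delta>\<close> over \<open>D\<close> in place of \<open>D\<close>. Only the Bell polynomials for \<open>k = 1\<close> and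
  \<open>k = p\<close> survive.
\<close>

lemma hochschild:
  assumes D: "derivation D" and \<delta>: "additive \<delta>"
    and leib: "\<And>g v. \<delta> (g *s v) = D g *s v + g *s \<delta> v"
  shows "((\<lambda>v. a *s \<delta> v) ^^ (p - 1)) (a *s v) =
    a ^ p *s (\<delta> ^^ (p - 1)) v + ((\<lambda>g. a * D g) ^^ (p - 1)) a *s v"
proof -
  have exp: "((\<lambda>v. a *s \<delta> v) ^^ n) (a *s v) = (\<Sum>k\<le>n. bell D a (Suc n) (Suc k) *s (\<delta> ^^ k) v)" for n
  proof (induction n)
    case 0
    show ?case using derivationD[OF D] by simp
  next
    case (Suc n)
    have "((\<lambda>v. a *s \<delta> v) ^^ Suc n) (a *s v) =
       (\<Sum>k\<le>n. (a * D (bell D a (Suc n) (Suc k))) *s (\<delta> ^^ k) v) +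
       (\<Sum>k\<le>n. (a * bell D a (Suc n) (Suc k)) *s (\<delta> ^^ Suc k) v)"
      by (simp add: Suc.IH additive.sum[OF \<delta>] leib scale_sum_right sum.distrib scale_right_distrib
          del: bell.simps)
    also have "(\<Sum>k\<le>n. (a * bell D a (Suc n) (Suc k)) *s (\<delta> ^^ Suc k) v) =
       (\<Sum>k\<le>Suc n. (a * bell D a (Suc n) k) *s (\<delta> ^^ k) v)"
      by (subst sum.atMost_Suc_shift) simp
    also have "(\<Sum>k\<le>n. (a * D (bell D a (Suc n) (Suc k))) *s (\<delta> ^^ k) v) =
       (\<Sum>k\<le>Suc n. (a * D (bell D a (Suc n) (Suc k))) *s (\<delta> ^^ k) v)"
      by (simp add: bell_eq_0[OF D] derivationD[OF D] del: bell.simps)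
    finally show ?case
      by (simp only: bell.simps(3)[of D a "Suc n"] scale_left_distrib sum.distrib)
  qed
  obtain m where m: "p = Suc (Suc m)"
    using le_Suc_ex[OF prime_ge_2_nat[OF p_prime]] by auto
  have "((\<lambda>v. a *s \<delta> v) ^^ (p - 1)) (a *s v) = (\<Sum>k\<le>Suc m. bell D a p (Suc k) *s (\<delta> ^^ k) v)"
    by (simp only: exp m diff_Suc_1)
  also have "\<dots> = bell D a p p *s (\<delta> ^^ Suc m) v + (\<Sum>k\<le>m. bell D a p (Suc k) *s (\<delta> ^^ k) v)"
    by (simp add: m add.commute del: bell.simps)
  also have "(\<Sum>k\<le>m. bell D a p (Suc k) *s (\<delta> ^^ k) v) = (\<Sum>k\<in>{0}. bell D a p (Suc k) *s (\<delta> ^^ k) v)"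
    by (rule sum.mono_neutral_right) (auto simp: m bell_p_eq_0[OF D, unfolded m] simp del: bell.simps)
  finally show ?thesis
    using bell_1[OF D, of a "Suc m"] bell_diag[OF D, of a p] by (simp add: m del: bell.simps)
qed

end

section \<open>Lie-Rinehart algebras\<close>

text \<open>
  The commutator of \<open>d\<close> with the \<open>n\<close>-th power of \<open>T\<close>, where \<open>R\<close> is the commutator of \<open>d\<close> with \<open>T\<close>.
\<close>

lemma derivation_funpow_expansion:
  fixes T :: "'b::ab_group_add \<Rightarrow> 'b"
  assumes T: "additive T" and d: "\<And>v. d (T v) = T (d v) + R v"
  shows "d ((T ^^ n) v) = (T ^^ n) (d v) + (\<Sum>j<n. (T ^^ j) (R ((T ^^ (n - Suc j)) v)))"
proof (induction n)
  case 0
  show ?case by simp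
next
  case (Suc n)
  have "d ((T ^^ Suc n) v) = T (d ((T ^^ n) v)) + R ((T ^^ n) v)"
    by (simp add: d)
  also have "\<dots> = (T ^^ Suc n) (d v) +
      (R ((T ^^ n) v) + (\<Sum>j<n. (T ^^ Suc j) (R ((T ^^ (n - Suc j)) v))))"
    by (simp add: Suc.IH additive.add[OF T] additive.sum[OF T])
  also have "R ((T ^^ n) v) + (\<Sum>j<n. (T ^^ Suc j) (R ((T ^^ (n - Suc j)) v))) =
      (\<Sum>j<Suc n. (T ^^ j) (R ((T ^^ (Suc n - Suc j)) v)))"
    by (subst sum.lessThan_Suc_shift) simp
  finally show ?case .
qed

text \<open>
  In the intended example the action is not faithful: among the jets of functions there is a central
  element that acts by zero.
\<close>

locale lie_rinehart = char_p_module scale p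
  for scale :: "'a::comm_ring_1 \<Rightarrow> 'b::ab_group_add \<Rightarrow> 'b" (infixr "*s" 75) and p :: nat +
  fixes act :: "'b \<Rightarrow> 'a \<Rightarrow> 'a" and br :: "'b \<Rightarrow> 'b \<Rightarrow> 'b"
  assumes act_add: "act (u + v) g = act u g + act v g"
    and act_scale: "act (a *s u) g = a * act u g"
    and act_derivation: "derivation (act u)"
    and br_add_right: "br u (v + w) = br u v + br u w"
    and br_skew: "br u v = - br v u"
    and br_self: "br u u = 0"
    and br_scale_right: "br u (a *s v) = act u a *s v + a *s br u v"
    and act_br: "act (br u v) g = act u (act v g) - act v (act u g)"
    and br_jacobi: "br u (br v w) = br (br u v) w + br v (br u w)"
begin

text \<open>
  The formal derivative of \<open>w \<mapsto> w^[p]\<close> in the direction \<open>v\<close>.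
\<close>

definition alpha :: "'b \<Rightarrow> 'b \<Rightarrow> 'b" where
  "alpha w v = (br w ^^ (p - 1)) v"

text \<open>
  The difference between \<open>(a u)^[p]\<close> and \<open>a^p u^[p]\<close>.
\<close>

definition hochschild_term :: "'a \<Rightarrow> 'b \<Rightarrow> 'b" where
  "hochschild_term a u = ((\<lambda>g. a * act u g) ^^ (p - 1)) a *s u"

text \<open>
  The derivative in a parameter, applied to coefficients, is of this kind.
\<close>

definition lr_derivation :: "('a \<Rightarrow> 'a) \<Rightarrow> ('b \<Rightarrow> 'b) \<Rightarrow> bool" where
  "lr_derivation dA dL \<longleftrightarrow> derivation dA \<and> additive dL \<and>
     (\<forall>a u. dL (a *s u) = dA a *s u + a *s dL u) \<and>
     (\<forall>u g. dA (act u g) = act (dL u) g + act u (dA g)) \<and>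
     (\<forall>u v. dL (br u v) = br (dL u) v + br u (dL v))"

lemma p_Suc: "p = Suc (p - 1)" "p - 1 - 1 = p - 2" "p - 1 = Suc (p - 2)"
  using prime_ge_2_nat[OF p_prime] by auto

lemma ring_module: "char_p_module ((*) :: 'a \<Rightarrow> 'a \<Rightarrow> 'a) p"
  by (intro char_p_module.intro module_mult char_p_axioms)

lemma additive_br: "additive (br u)"
  by (rule additive.intro) (rule br_add_right)

lemma additive_act: "additive (act u)"
  by (rule derivationD[OF act_derivation])

lemma br_add_left: "br (u + v) w = br u w + br v w"
  by (metis br_skew br_add_right minus_add_distrib)

lemma br_zero [simp]: "br u 0 = 0" "br 0 u = 0"
  using additive.zero[OF additive_br] br_skew[of 0 u] by auto

lemma br_scale_left: "br (a *s u) v = a *s br u v - act v a *s u"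
  using br_scale_right[of v a u] br_skew[of "a *s u" v] br_skew[of u v] by simp

lemma act_zero [simp]: "act u 0 = 0" "act 0 g = 0"
  using act_add[of 0 0 g] derivationD(3)[OF act_derivation] by auto

text \<open>
  The one-form \<open>alpha\<close> is closed: the mixed second derivatives of the virtual function \<open>w \<mapsto> w^[p]\<close>
  agree. Each of them is a pairing sum for the bracket, and the antisymmetry of the pairing cancels the
  antisymmetry of the bracket.
\<close>

lemma alpha_closed:
  assumes d: "lr_derivation dA d" and d': "lr_derivation dA' d'" and comm: "d (d' w) = d' (d w)"
  shows "d (alpha w (d' w)) = d' (alpha w (d w))"
proof -
  have exp: "e (alpha w v) = alpha w (e v) +
      (\<Sum>j<p - 1. (br w ^^ j) (br (e w) ((br w ^^ (p - 1 - Suc j)) v)))"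
    if "lr_derivation eA e" for eA e v
    unfolding alpha_def
    by (rule derivation_funpow_expansion[OF additive_br])
      (use that in \<open>simp add: lr_derivation_def add.commute\<close>)
  let ?Z = "\<lambda>i j. br ((br w ^^ i) (d w)) ((br w ^^ j) (d' w))"
  have "(\<Sum>j<p - 1. (br w ^^ j) (?Z 0 (p - 2 - j))) = - (\<Sum>j<p - 1. (br w ^^ j) (?Z (p - 2 - j) 0))"
    by (rule pairing_antisymmetry[OF additive_br]) (simp add: br_jacobi[of w])
  also have "\<dots> = (\<Sum>j<p - 1. (br w ^^ j) (br (d' w) ((br w ^^ (p - 2 - j)) (d w))))"
    unfolding sum_negf[symmetric] additive.minus[OF additive_funpow[OF additive_br], symmetric]
    by (simp add: br_skew[of "d' w"])
  finally show ?thesis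
    unfolding exp[OF d] exp[OF d'] comm by (simp add: numeral_2_eq_2)
qed

text \<open>
  The derivative of \<open>(a w)^[p] = a^p w^[p] + (a w)^(p-1)(a) w\<close>. It holds for an arbitrary derivation
  of the pair, and so contains both the derivative with respect to \<open>a\<close> and that with respect to \<open>w\<close>.
\<close>

lemma alpha_hochschild:
  assumes d: "lr_derivation dA d"
  shows "alpha (a *s w) (d (a *s w)) = a ^ p *s alpha w (d w) + d (hochschild_term a w)"
proof -
  let ?V = "d (a *s w)" and ?T = "br (a *s w)"
  let ?B = "\<lambda>g. a * act w g" and ?S = "\<lambda>v. a *s br w v"
  let ?Z = "\<lambda>i j. act ((?T ^^ i) ?V) ((?B ^^ j) a)"
  let ?c = "\<lambda>n. \<Sum>j<n. (?B ^^ j) (?Z (n - Suc j) 0)"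
  have dA: "derivation dA" and d_scale: "d (b *s v) = dA b *s v + b *s d v"
    and d_act: "dA (act v g) = act (d v) g + act v (dA g)" for b v g
    using d by (auto simp: lr_derivation_def)
  have B: "derivation ?B" by (rule derivation_mult_left[OF act_derivation])
  have addB: "additive ?B" by (rule derivationD(5)[OF B])
  have addS: "additive ?S" by (auto simp: additive_def br_add_right scale_right_distrib)
  have T: "?T v = ?S v - act v a *s w" for v by (rule br_scale_left)
  have S_w: "(?S ^^ n) (b *s w) = (?B ^^ n) b *s w" for n b
    by (induction n) (simp_all add: br_scale_right br_self)
  \<comment> \<open>Since \<open>T v = S v - v(a) w\<close>, the powers of \<open>T\<close> and \<open>S\<close> differ by a multiple of \<open>w\<close>.\<close>
  have exp: "(?T ^^ n) ?V = (?S ^^ n) ?V - ?c n *s w" for n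
  proof (induction n)
    case 0
    show ?case by simp
  next
    case (Suc n)
    have c: "?c (Suc n) = ?Z n 0 + ?B (?c n)"
      by (subst sum.lessThan_Suc_shift) (simp add: additive.sum[OF addB])
    have "(?T ^^ Suc n) ?V = ?S ((?T ^^ n) ?V) - ?Z n 0 *s w"
      by (simp add: T[of "(?T ^^ n) ?V"])
    also have "?S ((?T ^^ n) ?V) = (?S ^^ Suc n) ?V - ?B (?c n) *s w"
      using S_w[of 1 "?c n"] by (simp add: Suc.IH additive.diff[OF additive_br] scale_right_diff_distrib)
    finally show ?case unfolding c by (simp only: scale_left_distrib diff_diff_add add.commute)
  qed
  have "(\<Sum>j<p - 1. (?B ^^ j) (?Z 0 (p - 2 - j))) = - (\<Sum>j<p - 1. (?B ^^ j) (?Z (p - 2 - j) 0))"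
    by (rule char_p_module.pairing_antisymmetry[OF ring_module addB])
      (simp add: act_br act_scale)
  \<comment> \<open>This multiple is the pairing sum that also occurs in the derivative of \<open>(a w)^(p-1)(a)\<close>.\<close>
  then have c: "- ?c (p - 1) = (\<Sum>j<p - 1. (?B ^^ j) (act ?V ((?B ^^ (p - 1 - Suc j)) a)))"
    by (simp add: numeral_2_eq_2)
  have comm: "dA (?B g) = ?B (dA g) + act ?V g" for g
    by (simp add: derivationD(2)[OF dA] d_act d_scale act_add act_scale algebra_simps)
  have dB: "dA ((?B ^^ (p - 1)) a) = (?B ^^ (p - 1)) (dA a) + - ?c (p - 1)"
    unfolding derivation_funpow_expansion[of ?B dA "act ?V", OF addB comm] c ..
  have "(?S ^^ (p - 1)) ?V = (?S ^^ (p - 1)) (dA a *s w) + (?S ^^ (p - 1)) (a *s d w)"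
    by (simp only: d_scale additive.add[OF additive_funpow[OF addS]])
  also have "\<dots> = (?B ^^ (p - 1)) (dA a) *s w + (a ^ p *s alpha w (d w) + (?B ^^ (p - 1)) a *s d w)"
    unfolding S_w alpha_def
    using hochschild[OF act_derivation additive_br br_scale_right, of a w "d w"] by simp
  finally have S: "(?S ^^ (p - 1)) ?V = \<dots>" .
  have dh: "d (hochschild_term a w) = (?B ^^ (p - 1)) (dA a) *s w + (- ?c (p - 1)) *s w + (?B ^^ (p - 1)) a *s d w"
    unfolding hochschild_term_def d_scale dB by (simp only: scale_left_distrib)
  have gen: "x + (y + z) - c *s w = y + (x + (- c) *s w + z)" for x y z c
    unfolding scale_minus_left by (simp only: diff_conv_add_uminus add_ac)
  have "alpha (a *s w) ?V = (?S ^^ (p - 1)) ?V - ?c (p - 1) *s w"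
    unfolding alpha_def by (rule exp)
  then show ?thesis unfolding S dh by (simp only: gen)
qed

text \<open>
  The derivative of the p-th power of the operator \<open>act w\<close> is the action of \<open>alpha\<close>.
\<close>

lemma act_funpow_derivation:
  assumes d: "lr_derivation dA d"
  shows "dA ((act w ^^ p) g) = (act w ^^ p) (dA g) + act (alpha w (d w)) g"
proof -
  let ?Z = "\<lambda>i j. act ((br w ^^ i) (d w)) ((act w ^^ j) g)"
  have "(\<Sum>j<p. (act w ^^ j) (?Z 0 (p - 1 - j))) = ?Z (p - 1) 0"
    by (rule char_p_module.pairing_full[OF ring_module additive_act]) (simp add: act_br)
  then show ?thesis
    using derivation_funpow_expansion[of "act w" dA "act (d w)" p g, OF additive_act] d
    by (simp add: lr_derivation_def alpha_def add.commute)
qed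

end

section \<open>Polynomials with coefficients in an abelian group\<close>

text \<open>
  The coefficientwise extension of a biadditive operation to polynomials in a central variable \<open>t\<close>.
  With three different types it applies to brackets, actions and scalar multiplications alike.
\<close>

definition poly_ext :: "('u::zero \<Rightarrow> 'v::zero \<Rightarrow> 'w::ab_group_add) \<Rightarrow> 'u poly \<Rightarrow> 'v poly \<Rightarrow> 'w poly" where
  "poly_ext b f g = (\<Sum>i\<le>degree f. \<Sum>j\<le>degree g. monom (b (coeff f i) (coeff g j)) (i + j))"

lemma poly_br_eq_poly_ext: "poly_br br = poly_ext br"
  by (intro ext) (simp add: poly_br_def poly_ext_def)

lemma coeff_poly_ext_zero:
  assumes l: "\<And>j. b 0 (coeff g j) = 0" and r: "\<And>i. b (coeff f i) 0 = 0"
  shows "coeff (poly_ext b f g) n = (\<Sum>i\<le>n. b (coeff f i) (coeff g (n - i)))"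
proof -
  have inner: "(\<Sum>j\<le>degree g. if i + j = n then b (coeff f i) (coeff g j) else 0) =
      (if i \<le> n then b (coeff f i) (coeff g (n - i)) else 0)" for i
  proof (cases "i \<le> n")
    case True
    have "(\<Sum>j\<le>degree g. if i + j = n then b (coeff f i) (coeff g j) else 0) =
        (\<Sum>j\<le>degree g. if j = n - i then b (coeff f i) (coeff g j) else 0)"
      using True by (intro sum.cong) auto
    also have "\<dots> = b (coeff f i) (coeff g (n - i))"
      using r by (auto simp: sum.delta' coeff_eq_0)
    finally show ?thesis using True by simp
  next
    case False
    then show ?thesis by (intro trans[OF sum.neutral]) auto
  qed
  have "coeff (poly_ext b f g) n = (\<Sum>i\<le>degree f. if i \<le> n then b (coeff f i) (coeff g (n - i)) else 0)"
    by (simp add: poly_ext_def coeff_sum inner)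
  also have "\<dots> = (\<Sum>i\<in>{..degree f} \<inter> {..n}. b (coeff f i) (coeff g (n - i)))"
    by (subst sum.inter_restrict) (simp_all only: finite_atMost atMost_iff)
  also have "\<dots> = (\<Sum>i\<le>n. b (coeff f i) (coeff g (n - i)))"
  proof (rule sum.mono_neutral_left)
    show "\<forall>i\<in>{..n} - {..degree f} \<inter> {..n}. b (coeff f i) (coeff g (n - i)) = 0"
    proof
      fix i assume "i \<in> {..n} - {..degree f} \<inter> {..n}"
      then have "degree f < i" by auto
      then show "b (coeff f i) (coeff g (n - i)) = 0" by (simp add: coeff_eq_0 l)
    qed
  qed auto
  finally show ?thesis .
qed

definition biadditive :: "('u::ab_group_add \<Rightarrow> 'v::ab_group_add \<Rightarrow> 'w::ab_group_add) \<Rightarrow> bool" where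
  "biadditive b \<longleftrightarrow> (\<forall>x. additive (b x)) \<and> (\<forall>y. additive (\<lambda>x. b x y))"

lemma biadditiveD:
  assumes "biadditive b"
  shows "b (x + x') y = b x y + b x' y" "b x (y + y') = b x y + b x y'" "b 0 y = 0" "b x 0 = 0"
    "b (sum f X) y = (\<Sum>z\<in>X. b (f z) y)"
    "b x (sum g Y) = (\<Sum>z\<in>Y. b x (g z))"
  using assms additive.zero[of "b x"] additive.zero[of "\<lambda>x. b x y"]
    additive.sum[of "b x"] additive.sum[of "\<lambda>x. b x y"]
  by (auto simp: biadditive_def additive_def)

lemma coeff_poly_ext:
  "biadditive b \<Longrightarrow> coeff (poly_ext b f g) n = (\<Sum>i\<le>n. b (coeff f i) (coeff g (n - i)))"
  by (rule coeff_poly_ext_zero) (simp_all add: biadditiveD)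

lemma poly_ext_add:
  assumes "biadditive b"
  shows "poly_ext b (f + f') g = poly_ext b f g + poly_ext b f' g" "poly_ext b f (g + g') = poly_ext b f g + poly_ext b f g'"
  by (auto intro!: poly_eqI simp: coeff_poly_ext[OF assms] biadditiveD[OF assms] sum.distrib)

lemma biadditive_poly_ext: "biadditive b \<Longrightarrow> biadditive (poly_ext b)"
  using poly_ext_add[of b] by (auto simp: biadditive_def[of "poly_ext b"] additive_def)

lemma poly_ext_monom:
  assumes "biadditive b"
  shows "poly_ext b (monom x i) (monom y j) = monom (b x y) (i + j)"
proof (rule poly_eqI)
  fix n
  have "coeff (poly_ext b (monom x i) (monom y j)) n =
      (\<Sum>k\<le>n. if k = i then (if i + j = n then b x y else 0) else 0)"
    unfolding coeff_poly_ext[OF assms] by (intro sum.cong) (auto simp: biadditiveD[OF assms])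
  then show "coeff (poly_ext b (monom x i) (monom y j)) n = coeff (monom (b x y) (i + j)) n"
    by (simp add: sum.delta)
qed

lemma poly_ext_const:
  assumes "biadditive b"
  shows "poly_ext b [:x:] g = map_poly (b x) g"
proof (rule poly_eqI)
  fix n
  have "coeff (poly_ext b [:x:] g) n = (\<Sum>i\<le>n. if i = 0 then b x (coeff g n) else 0)"
    unfolding coeff_poly_ext[OF assms]
    by (intro sum.cong) (auto simp: biadditiveD[OF assms] coeff_pCons split: nat.split)
  then show "coeff (poly_ext b [:x:] g) n = coeff (map_poly (b x) g) n"
    by (simp add: sum.delta coeff_map_poly biadditiveD[OF assms])
qed

lemma poly_ext_const_right:
  assumes "biadditive b"
  shows "poly_ext b f [:y:] = map_poly (\<lambda>x. b x y) f"
proof (rule poly_eqI)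
  fix n
  have "coeff (poly_ext b f [:y:]) n = (\<Sum>i\<le>n. if i = n then b (coeff f n) y else 0)"
    unfolding coeff_poly_ext[OF assms]
    by (intro sum.cong) (auto simp: biadditiveD[OF assms] coeff_pCons split: nat.split)
  then show "coeff (poly_ext b f [:y:]) n = coeff (map_poly (\<lambda>x. b x y) f) n"
    by (simp add: coeff_map_poly biadditiveD[OF assms])
qed

lemma poly_ext_mult: "poly_ext (*) f g = f * (g :: 'a::comm_ring_1 poly)"
  by (rule poly_eqI) (simp add: coeff_poly_ext_zero coeff_mult)

lemma poly_monom_induct:
  assumes "\<And>a n. P (monom a n)" "\<And>f g. P f \<Longrightarrow> P g \<Longrightarrow> P (f + g)"
  shows "P (f :: 'a::comm_monoid_add poly)"
proof -
  have "P (\<Sum>i\<in>I. monom (coeff f i) i)" if "finite I" for I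
    using that assms(1)[of 0 0] by induction (simp_all add: assms)
  then show ?thesis using poly_as_sum_of_monoms[of f] by (metis finite_atMost)
qed

lemma poly_monom_induct2:
  assumes "\<And>a i b j. P (monom a i) (monom b j)"
    "\<And>f f' g. P f g \<Longrightarrow> P f' g \<Longrightarrow> P (f + f') g"
    "\<And>f g g'. P f g \<Longrightarrow> P f g' \<Longrightarrow> P f (g + g')"
  shows "P (f :: 'a::comm_monoid_add poly) (g :: 'b::comm_monoid_add poly)"
  by (rule poly_monom_induct[of "\<lambda>f. P f g"], rule poly_monom_induct[of "P _"]) (auto intro: assms)

lemma poly_monom_induct3:
  assumes "\<And>a i b j c k. P (monom a i) (monom b j) (monom c k)"
    "\<And>f f' g h. P f g h \<Longrightarrow> P f' g h \<Longrightarrow> P (f + f') g h"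
    "\<And>f g g' h. P f g h \<Longrightarrow> P f g' h \<Longrightarrow> P f (g + g') h"
    "\<And>f g h h'. P f g h \<Longrightarrow> P f g h' \<Longrightarrow> P f g (h + h')"
  shows "P (f :: 'a::comm_monoid_add poly) (g :: 'b::comm_monoid_add poly) (h :: 'c::comm_monoid_add poly)"
  by (rule poly_monom_induct2[of "\<lambda>f g. P f g h"], rule poly_monom_induct[of "P _ _"]) (auto intro: assms)

text \<open>
  The derivative in \<open>t\<close>; \<open>s\<close> is the scalar multiplication, used only with natural numbers.
\<close>

definition poly_deriv :: "('a::semiring_1 \<Rightarrow> 'b \<Rightarrow> 'b) \<Rightarrow> 'b::ab_group_add poly \<Rightarrow> 'b poly" where
  "poly_deriv s f = (\<Sum>i\<le>degree f. monom (s (of_nat i) (coeff f i)) (i - 1))"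

definition eval_one :: "'b::ab_group_add poly \<Rightarrow> 'b" where
  "eval_one f = (\<Sum>i\<le>degree f. coeff f i)"

lemma eval_one_bound: "(\<And>i. i > n \<Longrightarrow> coeff f i = 0) \<Longrightarrow> eval_one f = (\<Sum>i\<le>n. coeff f i)"
  unfolding eval_one_def
  by (rule sum.mono_neutral_cong) (auto simp: coeff_eq_0)

lemma eval_one_add [simp]: "eval_one (f + g) = eval_one f + eval_one g"
proof -
  let ?n = "max (degree f) (degree g)"
  have "eval_one f = (\<Sum>i\<le>?n. coeff f i)" "eval_one g = (\<Sum>i\<le>?n. coeff g i)"
    "eval_one (f + g) = (\<Sum>i\<le>?n. coeff (f + g) i)"
    by (rule eval_one_bound; auto simp: coeff_eq_0)+
  then show ?thesis by (simp add: sum.distrib)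
qed

lemma additive_eval_one: "additive eval_one"
  by (rule additive.intro) (rule eval_one_add)

lemma eval_one_monom [simp]: "eval_one (monom a n) = a"
  using eval_one_bound[of n "monom a n"] by (simp add: sum.delta)

lemma eval_one_pCons [simp]: "eval_one (pCons a f) = a + eval_one f"
proof -
  have "eval_one (pCons a f) = (\<Sum>i\<le>Suc (degree f). coeff (pCons a f) i)"
    by (rule eval_one_bound) (auto simp: coeff_pCons coeff_eq_0 split: nat.split)
  then show ?thesis by (simp add: sum.atMost_Suc_shift eval_one_def del: sum.atMost_Suc)
qed

lemma eval_one_0 [simp]: "eval_one 0 = 0"
  by (rule additive.zero[OF additive_eval_one])

lemma eval_one_poly_ext:
  assumes b: "biadditive b"
  shows "eval_one (poly_ext b f g) = b (eval_one f) (eval_one g)"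
  by (rule poly_monom_induct2[of "\<lambda>f g. eval_one (poly_ext b f g) = b (eval_one f) (eval_one g)"])
    (simp_all add: poly_ext_monom[OF b] poly_ext_add[OF b] biadditiveD[OF b])

lemma coeff_0_poly_ext: "biadditive b \<Longrightarrow> coeff (poly_ext b f g) 0 = b (coeff f 0) (coeff g 0)"
  by (simp add: coeff_poly_ext)

text \<open>
  The leading behaviour in formal degree \<open>c\<close>; the coefficient \<open>x\<close> may vanish. In this form it is
  multiplicative for every biadditive operation.
\<close>

definition top_coeff :: "nat \<Rightarrow> 'b::zero poly \<Rightarrow> 'b \<Rightarrow> bool" where
  "top_coeff c f x \<longleftrightarrow> (\<forall>n>c. coeff f n = 0) \<and> coeff f c = x"

lemma top_coeff_poly_ext:
  assumes b: "biadditive b" and f: "top_coeff c f x" and g: "top_coeff e g y"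
  shows "top_coeff (c + e) (poly_ext b f g) (b x y)"
proof -
  have z: "b (coeff f i) (coeff g (n - i)) = 0" if "n \<ge> c + e" "i \<le> n" "i \<noteq> c \<or> n > c + e" for n i
  proof (cases "i > c")
    case True
    then show ?thesis using f by (simp add: top_coeff_def biadditiveD[OF b])
  next
    case False
    then have "n - i > e" using that by auto
    then show ?thesis using g by (simp add: top_coeff_def biadditiveD[OF b])
  qed
  have "coeff (poly_ext b f g) (c + e) = (\<Sum>i\<in>{c}. b (coeff f i) (coeff g (c + e - i)))"
    unfolding coeff_poly_ext[OF b] by (rule sum.mono_neutral_right) (auto intro: z)
  moreover have "coeff (poly_ext b f g) n = 0" if "n > c + e" for n
    unfolding coeff_poly_ext[OF b] using that by (intro sum.neutral) (auto intro: z)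
  ultimately show ?thesis using f g by (simp add: top_coeff_def)
qed

lemma top_coeff_simps:
  "top_coeff 0 [:x:] x" "top_coeff 1 [:x, y:] y"
  by (auto simp: top_coeff_def coeff_pCons split: nat.split)

lemma funpow_intertwine:
  assumes "\<And>v. \<phi> (T v) = T' (\<phi> v)"
  shows "\<phi> ((T ^^ n) v) = (T' ^^ n) (\<phi> v)"
  by (induction n) (simp_all add: assms)

context module
begin

lemma biadditive_scale: "biadditive scale"
  by (auto simp: biadditive_def additive_def scale_left_distrib scale_right_distrib)

lemma module_poly_ext: "module (poly_ext scale)"
proof
  note b = biadditive_scale
  fix a b :: "'a poly" and x y :: "'b poly"
  show "poly_ext scale a (x + y) = poly_ext scale a x + poly_ext scale a y"
    "poly_ext scale (a + b) x = poly_ext scale a x + poly_ext scale b x"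
    by (rule poly_ext_add[OF b])+
  show "poly_ext scale a (poly_ext scale b x) = poly_ext scale (a * b) x"
    by (rule poly_monom_induct3[of "\<lambda>a b x. poly_ext scale a (poly_ext scale b x) = poly_ext scale (a * b) x"])
      (simp_all add: poly_ext_monom[OF b] poly_ext_add[OF b] mult_monom algebra_simps)
  have "poly_ext scale (monom 1 0) x = x"
    by (rule poly_monom_induct[of "\<lambda>x. poly_ext scale (monom 1 0) x = x"])
      (simp_all only: poly_ext_monom[OF b] poly_ext_add[OF b] scale_one add_0)
  then show "poly_ext scale 1 x = x"
    by (simp add: monom_0 one_pCons)
qed

lemma coeff_poly_deriv: "coeff (poly_deriv scale f) n = of_nat (Suc n) *s coeff f (Suc n)"
proof -
  have "coeff (poly_deriv scale f) n =
      (\<Sum>i\<le>degree f. if i = Suc n then of_nat (Suc n) *s coeff f (Suc n) else 0)"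
    unfolding poly_deriv_def coeff_sum
  proof (intro sum.cong refl)
    fix i
    show "coeff (monom (of_nat i *s coeff f i) (i - 1)) n =
        (if i = Suc n then of_nat (Suc n) *s coeff f (Suc n) else 0)"
      by (cases i) (auto simp del: of_nat_Suc)
  qed
  also have "\<dots> = of_nat (Suc n) *s coeff f (Suc n)"
    by (auto simp: sum.delta coeff_eq_0)
  finally show ?thesis .
qed

lemma poly_deriv_add: "poly_deriv scale (f + g) = poly_deriv scale f + poly_deriv scale g"
  by (rule poly_eqI) (simp add: coeff_poly_deriv scale_right_distrib)

lemma additive_poly_deriv: "additive (poly_deriv scale)"
  by (rule additive.intro) (rule poly_deriv_add)

lemma poly_deriv_monom: "poly_deriv scale (monom x n) = monom (of_nat n *s x) (n - 1)"
  by (cases n) (auto intro!: poly_eqI simp: coeff_poly_deriv simp del: of_nat_Suc)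

lemma poly_deriv_pCons_const [simp]: "poly_deriv scale [:x:] = 0" "poly_deriv scale [:x, y:] = [:y:]"
  by (auto intro!: poly_eqI simp: coeff_poly_deriv coeff_pCons split: nat.split)

end

lemma (in module) poly_deriv_poly_ext:
  fixes b :: "'u::ab_group_add \<Rightarrow> 'v::ab_group_add \<Rightarrow> 'b"
  assumes b: "biadditive b" and s: "module s" and s': "module s'"
    and "\<And>n x y. b (s (of_nat n) x) y = of_nat n *s b x y"
    and "\<And>n x y. b x (s' (of_nat n) y) = of_nat n *s b x y"
  shows "poly_deriv scale (poly_ext b f g) = poly_ext b (poly_deriv s f) g + poly_ext b f (poly_deriv s' g)"
proof (rule poly_monom_induct2[of "\<lambda>f g. poly_deriv scale (poly_ext b f g) = poly_ext b (poly_deriv s f) g + poly_ext b f (poly_deriv s' g)"])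
  fix x i y j
  show "poly_deriv scale (poly_ext b (monom x i) (monom y j)) =
      poly_ext b (poly_deriv s (monom x i)) (monom y j) + poly_ext b (monom x i) (poly_deriv s' (monom y j))"
    using assms(4)[of 0 x y] assms(5)[of x 0 y]
    by (cases i; cases j)
      (simp_all add: poly_ext_monom[OF b] poly_deriv_monom module.poly_deriv_monom[OF s] module.poly_deriv_monom[OF s'] assms(4,5)
        add_monom scale_left_distrib[symmetric] ac_simps biadditiveD[OF b]
        biadditiveD(3,4)[OF biadditive_poly_ext[OF b]]
        module.scale_zero_left[OF s] module.scale_zero_left[OF s'] del: of_nat_Suc flip: of_nat_add)
qed (simp_all add: poly_ext_add[OF b] poly_deriv_add module.poly_deriv_add[OF s] module.poly_deriv_add[OF s'])

section \<open>Integration in the polynomial variable\<close>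

text \<open>
  The inverse of a natural number below \<open>p\<close>, chosen in the ring itself, so that no ground field is
  involved.
\<close>

definition inv_nat :: "nat \<Rightarrow> 'a::comm_ring_1" where
  "inv_nat n = (SOME b. of_nat n * b = 1)"

context char_p
begin

lemma inv_nat: "0 < n \<Longrightarrow> n < p \<Longrightarrow> of_nat n * inv_nat n = (1::'a)"
  unfolding inv_nat_def by (rule someI_ex) (rule of_nat_less_inverse)

lemma inv_nat_unique:
  assumes "0 < n" "n < p" "of_nat n * b = (1::'a)" shows "inv_nat n = b"
proof -
  have "inv_nat n = (of_nat n * b) * inv_nat n" using assms by simp
  also have "\<dots> = (of_nat n * inv_nat n) * b" by (simp only: mult_ac)
  finally show ?thesis using inv_nat[OF assms(1,2)] by simp
qed

lemma char_p_poly: "char_p TYPE('a poly) p"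
  by unfold_locales (simp_all add: p_prime of_nat_monom p_zero)

lemma inv_nat_poly:
  assumes "0 < n" "n < p" shows "(inv_nat n :: 'a poly) = [:inv_nat n:]"
  by (rule char_p.inv_nat_unique[OF char_p_poly assms])
    (simp add: of_nat_monom monom_0 inv_nat[OF assms] mult.commute one_pCons)

lemma derivation_inv_nat:
  fixes dA :: "'a \<Rightarrow> 'a"
  assumes "derivation dA" "0 < n" "n < p" shows "dA (inv_nat n) = 0"
proof -
  have "0 = dA (of_nat n * inv_nat n)"
    by (simp add: inv_nat assms derivationD[OF assms(1)])
  also have "\<dots> = of_nat n * dA (inv_nat n)"
    by (simp add: derivationD(2,6)[OF assms(1)])
  finally have "inv_nat n * (of_nat n * dA (inv_nat n)) = 0" by simp
  then show ?thesis
    using inv_nat[OF assms(2,3)] by (simp add: mult.assoc[symmetric] mult.commute)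
qed

end

context char_p_module
begin

lemma char_p_module_poly: "char_p_module (poly_ext scale) p"
  by (intro char_p_module.intro module_poly_ext char_p_poly)

text \<open>
  The integral from \<open>0\<close> to \<open>1\<close> of the terms of degree less than \<open>p - 1\<close>; the term of degree
  \<open>p - 1\<close> has no primitive.
\<close>

definition integ :: "'b poly \<Rightarrow> 'b" where
  "integ f = (\<Sum>i = 1..p - 1. inv_nat i *s coeff f (i - 1))"

text \<open>
  The fundamental theorem of calculus modulo \<open>p\<close>: differentiation loses exactly the coefficients in
  degrees \<open>0\<close> and \<open>p\<close>.
\<close>

lemma eval_one_eq_integ:
  assumes "\<And>n. n > p \<Longrightarrow> coeff f n = 0"
  shows "eval_one f = coeff f 0 + coeff f p + integ (poly_deriv scale f)"
proof -
  have p: "p = Suc (p - 1)" using prime_gt_0_nat[OF p_prime] by simp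
  have "inv_nat i *s (of_nat i *s coeff f i) = coeff f i" if "0 < i" "i < p" for i
    using inv_nat[OF that] by (simp add: mult.commute)
  then have "integ (poly_deriv scale f) = (\<Sum>i = 1..p - 1. coeff f i)"
    unfolding integ_def by (intro sum.cong) (auto simp: coeff_poly_deriv simp del: of_nat_Suc)
  moreover have "{..p} = insert 0 (insert p {1..p - 1})" using p by auto
  moreover have "eval_one f = (\<Sum>i\<le>p. coeff f i)" by (rule eval_one_bound) (rule assms)
  ultimately show ?thesis
    using p by (simp add: add.assoc)
qed

lemma integ_add: "integ (f + g) = integ f + integ g"
  by (simp add: integ_def scale_right_distrib sum.distrib)

lemma integ_map:
  assumes "additive \<phi>" "\<And>i x. 0 < i \<Longrightarrow> i < p \<Longrightarrow> \<phi> (inv_nat i *s x) = inv_nat i *s \<phi> x"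
  shows "integ (map_poly \<phi> f) = \<phi> (integ f)"
  unfolding integ_def additive.sum[OF assms(1)]
  by (intro sum.cong) (auto simp: assms(2) coeff_map_poly additive.zero[OF assms(1)])

definition Lambda :: "('b \<Rightarrow> 'b \<Rightarrow> 'b) \<Rightarrow> 'b \<Rightarrow> 'b \<Rightarrow> 'b" where
  "Lambda br x y = (\<Sum>i = 1..p - 1. inv_nat i *s jacobson_s br p i x y)"

lemma Lambda_integ: "Lambda br x y = integ ((poly_ext br [:y, x:] ^^ (p - 1)) [:x:])"
  by (simp add: Lambda_def integ_def jacobson_s_def poly_br_eq_poly_ext)

end

context lie_rinehart
begin

lemma biadditive_br: "biadditive br"
  by (auto simp: biadditive_def additive_def br_add_left br_add_right)

lemma biadditive_act: "biadditive act"
  by (auto simp: biadditive_def additive_def act_add derivationD[OF act_derivation])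

text \<open>
  Every axiom is multiadditive, hence can be checked on monomials.
\<close>

lemma lie_rinehart_poly: "lie_rinehart (poly_ext scale) p (poly_ext act) (poly_ext br)"
proof (intro lie_rinehart.intro char_p_module_poly lie_rinehart_axioms.intro)
  note bb = biadditive_br and ba = biadditive_act and bs = biadditive_scale
  note bD = biadditiveD[OF bb] biadditiveD[OF ba] biadditiveD[OF bs]
  note pb = poly_ext_monom[OF bb] poly_ext_monom[OF ba] poly_ext_monom[OF bs]
    poly_ext_add[OF bb] poly_ext_add[OF ba] poly_ext_add[OF bs]
  fix u v w :: "'b poly" and a g :: "'a poly"
  show "poly_ext act (u + v) g = poly_ext act u g + poly_ext act v g" by (rule pb)
  show "poly_ext br u (v + w) = poly_ext br u v + poly_ext br u w" by (rule pb)
  show "poly_ext act (poly_ext scale a u) g = a * poly_ext act u g"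
    by (rule poly_monom_induct3[of "\<lambda>a u g. poly_ext act (poly_ext scale a u) g = a * poly_ext act u g"])
      (simp_all add: pb mult_monom act_scale algebra_simps)
  show "derivation (poly_ext act u)"
    unfolding derivation_def
  proof (intro conjI allI)
    show "additive (poly_ext act u)" by (rule additive.intro) (rule pb)
    fix f g
    show "poly_ext act u (f * g) = f * poly_ext act u g + g * poly_ext act u f"
      by (rule poly_monom_induct3[of "\<lambda>u f g. poly_ext act u (f * g) = f * poly_ext act u g + g * poly_ext act u f"])
        (simp_all add: pb mult_monom derivationD(2)[OF act_derivation] algebra_simps flip: add_monom)
  qed
  show skew: "poly_ext br u v = - poly_ext br v u" for u v
  proof -
    have "poly_ext br u v + poly_ext br v u = 0"
    proof (rule poly_monom_induct2[of "\<lambda>u v. poly_ext br u v + poly_ext br v u = 0"])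
      fix x y i j
      show "poly_ext br (monom x i) (monom y j) + poly_ext br (monom y j) (monom x i) = 0"
        using br_skew[of x y] by (simp add: pb add_monom add.commute[of j])
    next
      fix f g h
      have gen: "a + b + (c + d) = (a + c) + (b + d)" for a b c d :: "'b poly" by simp
      show "poly_ext br f h + poly_ext br h f = 0 \<Longrightarrow> poly_ext br g h + poly_ext br h g = 0 \<Longrightarrow>
        poly_ext br (f + g) h + poly_ext br h (f + g) = 0"
        "poly_ext br h f + poly_ext br f h = 0 \<Longrightarrow> poly_ext br h g + poly_ext br g h = 0 \<Longrightarrow>
        poly_ext br h (f + g) + poly_ext br (f + g) h = 0"
        unfolding pb by (subst gen, simp)+
    qed
    then show ?thesis by (simp add: eq_neg_iff_add_eq_0)
  qed
  show "poly_ext br u u = 0"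
  proof (rule poly_monom_induct[of "\<lambda>u. poly_ext br u u = 0"])
    fix f g
    show "poly_ext br f f = 0 \<Longrightarrow> poly_ext br g g = 0 \<Longrightarrow> poly_ext br (f + g) (f + g) = 0"
      using skew[of f g] by (simp add: pb)
  qed (simp add: pb br_self)
  show "poly_ext br u (poly_ext scale a v) = poly_ext scale (poly_ext act u a) v + poly_ext scale a (poly_ext br u v)"
    by (rule poly_monom_induct3[of "\<lambda>u a v. poly_ext br u (poly_ext scale a v) =
          poly_ext scale (poly_ext act u a) v + poly_ext scale a (poly_ext br u v)"])
      (simp_all add: pb br_scale_right add_monom algebra_simps)
  show "poly_ext act (poly_ext br u v) g = poly_ext act u (poly_ext act v g) - poly_ext act v (poly_ext act u g)"
    by (rule poly_monom_induct3[of "\<lambda>u v g. poly_ext act (poly_ext br u v) g =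
          poly_ext act u (poly_ext act v g) - poly_ext act v (poly_ext act u g)"])
      (simp_all add: pb act_br diff_monom algebra_simps)
  show "poly_ext br u (poly_ext br v w) = poly_ext br (poly_ext br u v) w + poly_ext br v (poly_ext br u w)"
  proof (rule poly_monom_induct3[of "\<lambda>u v w. poly_ext br u (poly_ext br v w) =
          poly_ext br (poly_ext br u v) w + poly_ext br v (poly_ext br u w)"])
    fix x i y j z k
    show "poly_ext br (monom x i) (poly_ext br (monom y j) (monom z k)) =
        poly_ext br (poly_ext br (monom x i) (monom y j)) (monom z k) +
        poly_ext br (monom y j) (poly_ext br (monom x i) (monom z k))"
      using br_jacobi[of x y z] by (simp add: pb add_monom ac_simps)
  qed (simp_all add: pb algebra_simps)
qed


lemma lr_derivation_poly_deriv:
  "lie_rinehart.lr_derivation (poly_ext scale) (poly_ext act) (poly_ext br) (poly_deriv (*)) (poly_deriv scale)"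
proof -
  interpret P: lie_rinehart "poly_ext scale" p "poly_ext act" "poly_ext br" by (rule lie_rinehart_poly)
  note m = module_axioms and mm = module_mult
  have n: "br (of_nat n *s x) y = of_nat n *s br x y" "br x (of_nat n *s y) = of_nat n *s br x y" for n x y
    by (simp_all add: br_scale_left br_scale_right derivationD(6)[OF act_derivation])
  show ?thesis
    unfolding P.lr_derivation_def derivation_def
  proof (intro conjI allI)
    show "additive (poly_deriv scale)" by (rule additive_poly_deriv)
    show "additive (poly_deriv (*) :: 'a poly \<Rightarrow> _)" by (rule module.additive_poly_deriv[OF mm])
    fix f g :: "'a poly" and u v :: "'b poly"
    show "poly_deriv (*) (f * g) = f * poly_deriv (*) g + g * poly_deriv (*) f"
      using module.poly_deriv_poly_ext[OF mm module.biadditive_scale[OF mm] mm mm, of f g]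
      by (simp add: poly_ext_mult algebra_simps)
    show "poly_deriv scale (poly_ext scale f u) = poly_ext scale (poly_deriv (*) f) u + poly_ext scale f (poly_deriv scale u)"
      by (rule poly_deriv_poly_ext[OF biadditive_scale mm m]) (simp_all add: mult.commute)
    show "poly_deriv (*) (poly_ext act u f) = poly_ext act (poly_deriv scale u) f + poly_ext act u (poly_deriv (*) f)"
      by (rule module.poly_deriv_poly_ext[OF mm biadditive_act m mm])
        (simp_all add: act_scale derivationD(2,6)[OF act_derivation])
    show "poly_deriv scale (poly_ext br u v) = poly_ext br (poly_deriv scale u) v + poly_ext br u (poly_deriv scale v)"
      by (rule poly_deriv_poly_ext[OF biadditive_br m m]) (simp_all add: n)
  qed
qed

lemma lr_derivation_map_poly:
  assumes d: "lr_derivation dA d"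
  shows "lie_rinehart.lr_derivation (poly_ext scale) (poly_ext act) (poly_ext br) (map_poly dA) (map_poly d)"
proof -
  interpret P: lie_rinehart "poly_ext scale" p "poly_ext act" "poly_ext br" by (rule lie_rinehart_poly)
  have dA: "derivation dA" and add: "additive d" using d by (auto simp: lr_derivation_def)
  have z: "dA 0 = 0" "d 0 = 0" by (simp_all add: derivationD[OF dA] additive.zero[OF add])
  have a: "map_poly dA (f + f') = map_poly dA f + map_poly dA f'"
    "map_poly d (u + u') = map_poly d u + map_poly d u'" for f f' u u'
    by (auto intro!: poly_eqI simp: coeff_map_poly z derivationD[OF dA] additive.add[OF add])
  note pb = poly_ext_monom[OF biadditive_br] poly_ext_monom[OF biadditive_act] poly_ext_monom[OF biadditive_scale]
    poly_ext_add[OF biadditive_br] poly_ext_add[OF biadditive_act] poly_ext_add[OF biadditive_scale]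
    mult_monom map_poly_monom[of d, OF z(2)] map_poly_monom[of dA, OF z(1)] a add_monom
  show ?thesis
    unfolding P.lr_derivation_def derivation_def
  proof (intro conjI allI)
    show "additive (map_poly dA)" "additive (map_poly d)" by (auto simp: additive_def a)
    fix f g :: "'a poly" and u v :: "'b poly"
    show "map_poly dA (f * g) = f * map_poly dA g + g * map_poly dA f"
      by (rule poly_monom_induct2[of "\<lambda>f g. map_poly dA (f * g) = f * map_poly dA g + g * map_poly dA f"])
        (simp_all add: pb derivationD(2)[OF dA] algebra_simps)
    show "map_poly d (poly_ext scale f u) = poly_ext scale (map_poly dA f) u + poly_ext scale f (map_poly d u)"
      by (rule poly_monom_induct2[of "\<lambda>f u. map_poly d (poly_ext scale f u) =
            poly_ext scale (map_poly dA f) u + poly_ext scale f (map_poly d u)"])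
        (use d in \<open>simp_all add: pb lr_derivation_def algebra_simps\<close>)
    show "map_poly dA (poly_ext act u f) = poly_ext act (map_poly d u) f + poly_ext act u (map_poly dA f)"
      by (rule poly_monom_induct2[of "\<lambda>u f. map_poly dA (poly_ext act u f) =
            poly_ext act (map_poly d u) f + poly_ext act u (map_poly dA f)"])
        (use d in \<open>simp_all add: pb lr_derivation_def algebra_simps\<close>)
    show "map_poly d (poly_ext br u v) = poly_ext br (map_poly d u) v + poly_ext br u (map_poly d v)"
      by (rule poly_monom_induct2[of "\<lambda>u v. map_poly d (poly_ext br u v) =
            poly_ext br (map_poly d u) v + poly_ext br u (map_poly d v)"])
        (use d in \<open>simp_all add: pb lr_derivation_def algebra_simps\<close>)
  qed
qed

lemma alpha_top_coeff:
  assumes w: "top_coeff 1 w w1" and v: "top_coeff c v v1"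
  shows "top_coeff (n + c) ((poly_ext br w ^^ n) v) ((br w1 ^^ n) v1)"
proof (induction n)
  case 0
  show ?case using v by simp
next
  case (Suc n)
  show ?case using top_coeff_poly_ext[OF biadditive_br w Suc.IH] by simp
qed

text \<open>
  \<open>Lambda u z\<close> is the difference \<open>(z + u)^[p] - z^[p] - u^[p]\<close> as far as derivatives can tell. The
  closedness of \<open>alpha\<close>, applied to \<open>d\<close> and to the derivative in \<open>t\<close> along \<open>z + tu\<close>, interchanges
  \<open>d\<close> with the integral that defines \<open>Lambda\<close>.
\<close>

lemma Lambda_derivation:
  assumes d: "lr_derivation dA d"
  shows "d (Lambda br u z) = alpha (z + u) (d (z + u)) - alpha z (d z) - alpha u (d u)"
proof -
  interpret P: lie_rinehart "poly_ext scale" p "poly_ext act" "poly_ext br" by (rule lie_rinehart_poly)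
  have dA: "derivation dA" and add: "additive d" using d by (auto simp: lr_derivation_def)
  have d0: "d 0 = 0" by (rule additive.zero[OF add])
  let ?w = "[:z, u:]"
  \<comment> \<open>The derivative of \<open>(z + tu)^[p]\<close> under \<open>d\<close>; its values at \<open>t = 1\<close>, at \<open>t = 0\<close> and in degree \<open>p\<close> are the three terms.\<close>
  let ?F = "P.alpha ?w (map_poly d ?w)"
  have m: "map_poly d [:a, b:] = [:d a, d b:]" "map_poly d [:a:] = [:d a:]" for a b
    using d0 by (simp_all add: map_poly_pCons)
  have "map_poly d (P.alpha ?w (poly_deriv scale ?w)) = poly_deriv scale ?F"
    by (rule P.alpha_closed[OF lr_derivation_map_poly[OF d] lr_derivation_poly_deriv]) (simp add: m)
  then have "integ (poly_deriv scale ?F) = integ (map_poly d (P.alpha ?w [:u:]))"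
    by simp
  also have "\<dots> = d (integ (P.alpha ?w [:u:]))"
  proof (rule integ_map[OF add])
    fix i x assume "0 < i" "i < p"
    then show "d (inv_nat i *s x) = inv_nat i *s d x"
      using d derivation_inv_nat[OF dA] by (simp add: lr_derivation_def)
  qed
  also have "\<dots> = d (Lambda br u z)"
    by (simp add: Lambda_integ P.alpha_def)
  finally have 1: "integ (poly_deriv scale ?F) = d (Lambda br u z)" .
  have top: "top_coeff (p - 1 + 1) ?F (alpha u (d u))"
    unfolding P.alpha_def alpha_def m by (rule alpha_top_coeff; rule top_coeff_simps)
  then have top: "top_coeff p ?F (alpha u (d u))" using p_Suc by simp
  have 2: "coeff ?F 0 = alpha z (d z)"
    unfolding P.alpha_def alpha_def
    by (subst funpow_intertwine[of "\<lambda>f. coeff f 0" _ "br z"]) (simp_all add: coeff_0_poly_ext[OF biadditive_br] m)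
  have 3: "eval_one ?F = alpha (z + u) (d (z + u))"
    unfolding P.alpha_def alpha_def
    by (subst funpow_intertwine[of eval_one _ "br (z + u)"])
      (simp_all add: eval_one_poly_ext[OF biadditive_br] m additive.add[OF add])
  have "eval_one ?F = coeff ?F 0 + coeff ?F p + integ (poly_deriv scale ?F)"
    by (rule eval_one_eq_integ) (use top in \<open>simp add: top_coeff_def\<close>)
  then show ?thesis
    unfolding 1 2 3 using top by (simp add: top_coeff_def)
qed

text \<open>
  The integrated form of \<open>alpha_hochschild\<close> along a path on which \<open>a\<close> or \<open>w\<close> moves linearly in \<open>t\<close>
  while the other one is constant. The boundary terms are Hochschild terms at \<open>t = 1\<close>, at \<open>t = 0\<close>, and
  in the top degree \<open>p\<close>.
\<close>

lemma integ_poly_deriv_hochschild: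
  assumes a: "top_coeff c a a1" and w: "top_coeff e w w1" and ce: "c + e = 1"
  defines "aw \<equiv> poly_ext scale a w"
  shows "integ ((poly_ext br aw ^^ (p - 1)) (poly_deriv scale aw)) =
    integ (poly_ext scale (a ^ p) ((poly_ext br w ^^ (p - 1)) (poly_deriv scale w))) +
    hochschild_term (eval_one a) (eval_one w) - hochschild_term (coeff a 0) (coeff w 0) - hochschild_term a1 w1"
proof -
  interpret P: lie_rinehart "poly_ext scale" p "poly_ext act" "poly_ext br" by (rule lie_rinehart_poly)
  note mm = module.biadditive_scale[OF module_mult]
  let ?F = "P.hochschild_term a w"
  have "P.alpha aw (poly_deriv scale aw) = poly_ext scale (a ^ p) (P.alpha w (poly_deriv scale w)) + poly_deriv scale ?F"
    unfolding aw_def by (rule P.alpha_hochschild[OF lr_derivation_poly_deriv])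
  then have 1: "integ ((poly_ext br aw ^^ (p - 1)) (poly_deriv scale aw)) =
      integ (poly_ext scale (a ^ p) ((poly_ext br w ^^ (p - 1)) (poly_deriv scale w))) + integ (poly_deriv scale ?F)"
    by (simp add: P.alpha_def integ_add)
  have top: "top_coeff (n + c) (((\<lambda>g. a * poly_ext act w g) ^^ n) a) (((\<lambda>g. a1 * act w1 g) ^^ n) a1)" for n
  proof (induction n)
    case 0
    show ?case using a by simp
  next
    case (Suc n)
    have eq: "c + (e + (n + c)) = Suc n + c" using ce by simp
    show ?case
      using top_coeff_poly_ext[OF mm a top_coeff_poly_ext[OF biadditive_act w Suc.IH]]
      unfolding eq poly_ext_mult by simp
  qed
  have "p - 1 + c + e = p" using ce p_Suc by simp
  then have top: "top_coeff p ?F (hochschild_term a1 w1)"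
    using top_coeff_poly_ext[OF biadditive_scale top[of "p - 1"] w] by (simp add: P.hochschild_term_def hochschild_term_def)
  have 2: "coeff ?F 0 = hochschild_term (coeff a 0) (coeff w 0)"
    unfolding P.hochschild_term_def hochschild_term_def coeff_0_poly_ext[OF biadditive_scale]
    by (subst funpow_intertwine[of "\<lambda>f. coeff f 0" _ "\<lambda>g. coeff a 0 * act (coeff w 0) g"])
      (simp_all add: coeff_0_poly_ext[OF biadditive_act] coeff_mult_0)
  have 3: "eval_one ?F = hochschild_term (eval_one a) (eval_one w)"
    unfolding P.hochschild_term_def hochschild_term_def eval_one_poly_ext[OF biadditive_scale]
    by (subst funpow_intertwine[of eval_one _ "\<lambda>g. eval_one a * act (eval_one w) g"])
      (simp_all add: eval_one_poly_ext[OF biadditive_act] eval_one_poly_ext[OF mm] flip: poly_ext_mult)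
  have "eval_one ?F = coeff ?F 0 + coeff ?F p + integ (poly_deriv scale ?F)"
    by (rule eval_one_eq_integ) (use top in \<open>simp add: top_coeff_def\<close>)
  then show ?thesis
    unfolding 1 2 3 using top by (simp add: top_coeff_def)
qed

text \<open>
  Compatibility of the two rules for a p-map on \<open>(a + b) u\<close>.
\<close>

lemma hochschild_add_left:
  "hochschild_term (a + b) u = hochschild_term a u + hochschild_term b u + Lambda br (a *s u) (b *s u)"
proof -
  interpret P: lie_rinehart "poly_ext scale" p "poly_ext act" "poly_ext br" by (rule lie_rinehart_poly)
  have s: "poly_ext scale [:b, a:] [:u:] = [:b *s u, a *s u:]"
    by (simp add: poly_ext_const_right[OF biadditive_scale] map_poly_pCons)
  have z: "(poly_ext br [:u:] ^^ n) 0 = 0" for n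
    using funpow_intertwine[of "\<lambda>_. 0" "poly_ext br [:u:]" "poly_ext br [:u:]"] by simp
  show ?thesis
    using integ_poly_deriv_hochschild[OF top_coeff_simps(2)[of b a] top_coeff_simps(1)[of u]]
    by (simp add: s z Lambda_integ) (simp add: integ_def algebra_simps)
qed

text \<open>
  Compatibility of the two rules for a p-map on \<open>a (u + v)\<close>.
\<close>

lemma hochschild_add_right:
  "hochschild_term a (u + v) + a ^ p *s Lambda br u v = hochschild_term a u + hochschild_term a v + Lambda br (a *s u) (a *s v)"
proof -
  interpret P: lie_rinehart "poly_ext scale" p "poly_ext act" "poly_ext br" by (rule lie_rinehart_poly)
  have s: "poly_ext scale [:a:] f = map_poly (scale a) f" for a f
    by (rule poly_ext_const[OF biadditive_scale])
  have i: "integ (poly_ext scale [:a:] f) = a *s integ f" for a f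
    unfolding s by (rule integ_map) (auto simp: additive_def scale_right_distrib mult.commute)
  have pw: "[:a:] ^ p = [:a ^ p:]" by (induction p) (simp_all add: one_pCons)
  show ?thesis
    using integ_poly_deriv_hochschild[OF top_coeff_simps(1)[of a] top_coeff_simps(2)[of v u]]
    by (simp add: i pw Lambda_integ) (simp add: s map_poly_pCons algebra_simps)
qed

text \<open>
  Jacobson's formula for the operators \<open>act u\<close> and \<open>act v\<close>.
\<close>

lemma act_Lambda:
  "(act (u + v) ^^ p) g = (act u ^^ p) g + (act v ^^ p) g + act (Lambda br u v) g"
proof -
  interpret P: lie_rinehart "poly_ext scale" p "poly_ext act" "poly_ext br" by (rule lie_rinehart_poly)
  interpret R: char_p_module "(*) :: 'a \<Rightarrow> _" p by (rule ring_module)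
  let ?w = "[:v, u:]"
  let ?F = "(poly_ext act ?w ^^ p) [:g:]"
  have top: "top_coeff n ((poly_ext act ?w ^^ n) [:g:]) ((act u ^^ n) g)" for n
  proof (induction n)
    case 0
    show ?case by (simp add: top_coeff_simps)
  next
    case (Suc n)
    show ?case using top_coeff_poly_ext[OF biadditive_act top_coeff_simps(2) Suc.IH] by simp
  qed
  have z: "(poly_ext act ?w ^^ p) 0 = 0"
    using funpow_intertwine[of "\<lambda>_. 0" "poly_ext act ?w" "poly_ext act ?w"] by simp
  have "poly_deriv (*) ?F = poly_ext act (P.alpha ?w [:u:]) [:g:]"
    using P.act_funpow_derivation[OF lr_derivation_poly_deriv, of ?w "[:g:]"] by (simp add: z)
  also have "\<dots> = map_poly (\<lambda>v. act v g) (P.alpha ?w [:u:])"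
    by (rule poly_ext_const_right[OF biadditive_act])
  finally have "R.integ (poly_deriv (*) ?F) = act (Lambda br u v) g"
    by (simp add: R.integ_def Lambda_integ integ_def P.alpha_def coeff_map_poly act_scale
        biadditiveD(5)[OF biadditive_act])
  moreover have "eval_one ?F = (act (u + v) ^^ p) g"
    by (subst funpow_intertwine[of eval_one _ "act (v + u)"])
      (simp_all add: eval_one_poly_ext[OF biadditive_act] add.commute)
  moreover have "coeff ?F 0 = (act v ^^ p) g"
    by (subst funpow_intertwine[of "\<lambda>f. coeff f 0" _ "act v"])
      (simp_all add: coeff_0_poly_ext[OF biadditive_act])
  moreover have "eval_one ?F = coeff ?F 0 + coeff ?F p + R.integ (poly_deriv (*) ?F)"
    by (rule R.eval_one_eq_integ) (use top[of p] in \<open>simp add: top_coeff_def\<close>)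
  ultimately show ?thesis
    using top[of p] by (simp add: top_coeff_def add_ac)
qed

end

section \<open>Jacobson's polynomial is a symmetric cocycle\<close>

text \<open>
  Naturality of the polynomials \<open>s_i\<close>. The first bracket is controlled on the subset \<open>L\<close> only.
\<close>

lemma jacobson_s_hom:
  fixes br :: "'u::ab_group_add \<Rightarrow> 'u \<Rightarrow> 'u" and br' :: "'v::ab_group_add \<Rightarrow> 'v \<Rightarrow> 'v"
  assumes L: "0 \<in> L" "\<And>x y. x \<in> L \<Longrightarrow> y \<in> L \<Longrightarrow> x + y \<in> L" "\<And>x y. x \<in> L \<Longrightarrow> y \<in> L \<Longrightarrow> br x y \<in> L"
    and br0: "\<And>x. x \<in> L \<Longrightarrow> br 0 x = 0" "\<And>x. x \<in> L \<Longrightarrow> br x 0 = 0"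
    and br': "biadditive br'"
    and \<phi>: "\<And>x y. x \<in> L \<Longrightarrow> y \<in> L \<Longrightarrow> \<phi> (x + y) = \<phi> x + \<phi> y"
      "\<And>x y. x \<in> L \<Longrightarrow> y \<in> L \<Longrightarrow> \<phi> (br x y) = br' (\<phi> x) (\<phi> y)"
    and xy: "x \<in> L" "y \<in> L"
  shows "jacobson_s br p i x y \<in> L" "\<phi> (jacobson_s br p i x y) = jacobson_s br' p i (\<phi> x) (\<phi> y)"
proof -
  have \<phi>0: "\<phi> 0 = 0" using \<phi>(1)[OF L(1) L(1)] by simp
  have sum: "sum f I \<in> L \<and> \<phi> (sum f I) = (\<Sum>i\<in>I. \<phi> (f i))" if "\<And>i. i \<in> I \<Longrightarrow> f i \<in> L" for f and I :: "nat set"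
    using that by (induction I rule: infinite_finite_induct) (auto simp: L \<phi> \<phi>0)
  have step: "(\<forall>n. coeff (poly_ext br f g) n \<in> L) \<and> map_poly \<phi> (poly_ext br f g) = poly_ext br' (map_poly \<phi> f) (map_poly \<phi> g)"
    if f: "\<forall>n. coeff f n \<in> L" and g: "\<forall>n. coeff g n \<in> L" for f g
  proof -
    have c: "coeff (poly_ext br f g) n = (\<Sum>i\<le>n. br (coeff f i) (coeff g (n - i)))" for n
      by (rule coeff_poly_ext_zero) (use f g br0 in auto)
    have "coeff (poly_ext br f g) n \<in> L" for n
      unfolding c using sum[of "{..n}" "\<lambda>i. br (coeff f i) (coeff g (n - i))"] f g L(3) by blast
    moreover have "map_poly \<phi> (poly_ext br f g) = poly_ext br' (map_poly \<phi> f) (map_poly \<phi> g)"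
    proof (rule poly_eqI)
      fix n
      have "\<phi> (coeff (poly_ext br f g) n) = (\<Sum>i\<le>n. \<phi> (br (coeff f i) (coeff g (n - i))))"
        unfolding c using sum[of "{..n}" "\<lambda>i. br (coeff f i) (coeff g (n - i))"] f g L(3) by blast
      then show "coeff (map_poly \<phi> (poly_ext br f g)) n = coeff (poly_ext br' (map_poly \<phi> f) (map_poly \<phi> g)) n"
        using f g by (simp add: coeff_poly_ext[OF br'] coeff_map_poly \<phi>0 \<phi>(2))
    qed
    ultimately show ?thesis by blast
  qed
  let ?w = "[:y, x:]"
  have w: "\<forall>n. coeff ?w n \<in> L" and x: "\<forall>n. coeff [:x:] n \<in> L"
    using xy L(1) by (auto simp: coeff_pCons split: nat.split)
  have m: "map_poly \<phi> ?w = [:\<phi> y, \<phi> x:]" "map_poly \<phi> [:x:] = [:\<phi> x:]"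
    by (simp_all add: map_poly_pCons \<phi>0)
  have it: "(\<forall>k. coeff ((poly_ext br ?w ^^ n) [:x:]) k \<in> L) \<and>
    map_poly \<phi> ((poly_ext br ?w ^^ n) [:x:]) = (poly_ext br' [:\<phi> y, \<phi> x:] ^^ n) [:\<phi> x:]" for n
  proof (induction n)
    case 0
    show ?case using x m by simp
  next
    case (Suc n)
    then show ?case using step[OF w, of "(poly_ext br ?w ^^ n) [:x:]"] m by simp
  qed
  show "jacobson_s br p i x y \<in> L"
    using it unfolding jacobson_s_def poly_br_eq_poly_ext by blast
  have "coeff (map_poly \<phi> ((poly_ext br ?w ^^ (p - 1)) [:x:])) (i - 1) = jacobson_s br' p i (\<phi> x) (\<phi> y)"
    using it unfolding jacobson_s_def poly_br_eq_poly_ext by simp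
  then show "\<phi> (jacobson_s br p i x y) = jacobson_s br' p i (\<phi> x) (\<phi> y)"
    by (simp add: coeff_map_poly \<phi>0 jacobson_s_def poly_br_eq_poly_ext)
qed

text \<open>
  A bound on the degree in the inner variable \<open>t\<close> that may grow with the degree \<open>j\<close> in the outer
  variable. The slopes \<open>r = 0\<close> and \<open>r = 1\<close> serve for \<open>t\<close> in the second and in the first argument of
  \<open>Lambda\<close>.
\<close>

definition t_degree_le :: "nat \<Rightarrow> nat \<Rightarrow> 'b::zero poly poly \<Rightarrow> bool" where
  "t_degree_le r c F \<longleftrightarrow> (\<forall>j n. n > r * j + c \<longrightarrow> coeff (coeff F j) n = 0)"

lemma t_degree_le_poly_ext:
  assumes b: "biadditive b" and F: "t_degree_le r c F" and G: "t_degree_le r e G"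
  shows "t_degree_le r (c + e) (poly_ext (poly_ext b) F G)"
  unfolding t_degree_le_def
proof (intro allI impI)
  fix j n assume n: "n > r * j + (c + e)"
  have "b (coeff (coeff F i) k) (coeff (coeff G (j - i)) (n - k)) = 0" if "i \<le> j" "k \<le> n" for i k
  proof (cases "k > r * i + c")
    case True
    then show ?thesis using F by (simp add: t_degree_le_def biadditiveD[OF b])
  next
    case False
    have "r * j = r * i + r * (j - i)" using that(1) by (metis add_mult_distrib2 le_add_diff_inverse)
    then have "n - k > r * (j - i) + e" using False n by linarith
    then show ?thesis using G by (simp add: t_degree_le_def biadditiveD[OF b])
  qed
  then show "coeff (coeff (poly_ext (poly_ext b) F G) j) n = 0"
    by (simp add: coeff_poly_ext[OF biadditive_poly_ext[OF b]] coeff_sum coeff_poly_ext[OF b])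
qed

lemma t_degree_le_funpow:
  fixes b :: "'u::ab_group_add \<Rightarrow> 'v::ab_group_add \<Rightarrow> 'v"
  assumes b: "biadditive b" and F: "t_degree_le r c F" and G: "t_degree_le r e G"
  shows "t_degree_le r (m * c + e) ((poly_ext (poly_ext b) F ^^ m) G)"
proof (induction m)
  case 0
  show ?case using G by simp
next
  case (Suc m)
  show ?case using t_degree_le_poly_ext[OF b F Suc.IH] by (simp add: add.assoc)
qed

context lie_rinehart
begin

abbreviation "Lambda_poly \<equiv> char_p_module.Lambda (poly_ext scale) p (poly_ext br)"

lemma coeff_Lambda_poly:
  "coeff (Lambda_poly u v) n = (\<Sum>i = 1..p - 1. inv_nat i *s coeff (jacobson_s (poly_ext br) p i u v) n)"
  unfolding char_p_module.Lambda_def[OF char_p_module_poly] coeff_sum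
  by (intro sum.cong refl)
    (auto simp: inv_nat_poly poly_ext_const[OF biadditive_scale] coeff_map_poly)

lemma Lambda_poly_hom:
  assumes "additive \<phi>" "\<And>f g. \<phi> (poly_ext br f g) = br (\<phi> f) (\<phi> g)"
    and "\<And>a f. \<phi> (map_poly (scale a) f) = a *s \<phi> f"
  shows "\<phi> (Lambda_poly u v) = Lambda br (\<phi> u) (\<phi> v)"
proof -
  have "\<phi> (jacobson_s (poly_ext br) p i u v) = jacobson_s br p i (\<phi> u) (\<phi> v)" for i
    by (rule jacobson_s_hom[where L = UNIV])
      (simp_all add: assms additive.add biadditiveD(3,4)[OF biadditive_poly_ext] biadditive_br)
  then show ?thesis
    unfolding char_p_module.Lambda_def[OF char_p_module_poly] Lambda_def additive.sum[OF assms(1)]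
    by (intro sum.cong refl)
      (auto simp: inv_nat_poly poly_ext_const[OF biadditive_scale] assms(3))
qed

lemma eval_one_Lambda_poly: "eval_one (Lambda_poly u v) = Lambda br (eval_one u) (eval_one v)"
proof (rule Lambda_poly_hom)
  show "eval_one (map_poly (scale a) f) = a *s eval_one f" for a f
    using eval_one_poly_ext[OF biadditive_scale, of "[:a:]" f] by (simp add: poly_ext_const[OF biadditive_scale])
qed (simp_all add: additive_eval_one eval_one_poly_ext[OF biadditive_br])

lemma coeff_0_Lambda_poly: "coeff (Lambda_poly u v) 0 = Lambda br (coeff u 0) (coeff v 0)"
  by (rule Lambda_poly_hom)
    (simp_all add: additive_def coeff_0_poly_ext[OF biadditive_br] coeff_map_poly)

lemma coeff_Lambda_poly_right:
  assumes "n \<ge> p"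
  shows "coeff (Lambda_poly [:z:] [:y, x:]) n = 0"
proof -
  have "t_degree_le 0 ((p - 1) * 1 + 0) ((poly_ext (poly_ext br) [:[:y, x:], [:z:]:] ^^ (p - 1)) [:[:z:]:])"
    by (rule t_degree_le_funpow[OF biadditive_br])
      (auto simp: t_degree_le_def coeff_pCons split: nat.split)
  then have "coeff (jacobson_s (poly_ext br) p i [:z:] [:y, x:]) n = 0" for i
    using assms p_Suc(1) by (simp add: t_degree_le_def jacobson_s_def poly_br_eq_poly_ext)
  then show ?thesis by (simp add: coeff_Lambda_poly)
qed

text \<open>
  Each factor \<open>t\<close> comes with a factor of the outer variable, except for one in the innermost
  argument; in \<open>s_i\<close> with \<open>i < p\<close> the degree in \<open>t\<close> is at most \<open>i\<close>.
\<close>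

lemma coeff_Lambda_poly_left:
  assumes "n \<ge> p"
  shows "coeff (Lambda_poly [:0, x:] [:y:]) n = 0"
proof -
  have "t_degree_le 1 ((p - 1) * 0 + 1) ((poly_ext (poly_ext br) [:[:y:], [:0, x:]:] ^^ (p - 1)) [:[:0, x:]:])"
    by (rule t_degree_le_funpow[OF biadditive_br])
      (auto simp: t_degree_le_def coeff_pCons split: nat.split)
  then have "coeff (jacobson_s (poly_ext br) p i [:0, x:] [:y:]) n = 0" if "i \<le> p - 1" for i
    using assms p_Suc(1,3) that by (auto simp: t_degree_le_def jacobson_s_def poly_br_eq_poly_ext)
  then show ?thesis by (simp add: coeff_Lambda_poly)
qed

lemma Lambda_commuting:
  assumes "br u v = 0" shows "Lambda br u v = 0"
proof -
  have fix0: "(poly_ext br w ^^ n) 0 = 0" for w n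
    using funpow_intertwine[of "\<lambda>_. 0" "poly_ext br w" "poly_ext br w"] biadditiveD(4)[OF biadditive_poly_ext[OF biadditive_br]]
    by metis
  have "poly_ext br [:v, u:] [:u:] = 0"
    using assms br_skew[of v u]
    by (simp add: poly_ext_const_right[OF biadditive_br] map_poly_pCons br_self)
  then have "(poly_ext br [:v, u:] ^^ Suc (p - 2)) [:u:] = 0"
    unfolding funpow_Suc_right by (simp add: fix0)
  then show ?thesis
    unfolding Lambda_integ p_Suc(3) by (simp add: integ_def del: funpow.simps)
qed

lemma Lambda_zero [simp]: "Lambda br 0 x = 0" "Lambda br x 0 = 0"
  by (simp_all add: Lambda_commuting)

lemma poly_eq_0_by_poly_deriv:
  assumes "poly_deriv scale f = 0" "coeff f 0 = 0" "\<And>n. n \<ge> p \<Longrightarrow> coeff f n = 0"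
  shows "f = (0 :: 'b poly)"
proof (rule poly_eqI)
  fix n
  consider "n = 0" | "n \<ge> p" | "0 < n" "n < p" by linarith
  then show "coeff f n = coeff 0 n"
  proof cases
    case 3
    have "coeff (poly_deriv scale f) (n - 1) = of_nat n *s coeff f n"
      using 3 by (simp add: coeff_poly_deriv)
    then have "of_nat n *s coeff f n = 0" using assms(1) by simp
    then have "inv_nat n *s (of_nat n *s coeff f n) = 0" by simp
    then show ?thesis using inv_nat[OF 3] by (simp add: mult.commute)
  qed (use assms in auto)
qed

lemma alpha_0 [simp]: "alpha w 0 = 0"
  unfolding alpha_def by (rule additive.zero[OF additive_funpow[OF additive_br]])

text \<open>
  Replace \<open>x\<close> by \<open>tx\<close>. The derivatives of both sides consist of the same values of \<open>alpha\<close>, the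
  degrees in \<open>t\<close> are below \<open>p\<close>, and the equation is clear for \<open>t = 0\<close>.
\<close>

lemma Lambda_cocycle: "Lambda br z (y + x) + Lambda br y x = Lambda br z y + Lambda br (z + y) x"
proof -
  interpret P: lie_rinehart "poly_ext scale" p "poly_ext act" "poly_ext br" by (rule lie_rinehart_poly)
  let ?Q = "Lambda_poly [:z:] [:y, x:] + Lambda_poly [:y:] [:0, x:] -
    (Lambda_poly [:z:] [:y, 0:] + Lambda_poly [:z + y:] [:0, x:])"
  note D = P.Lambda_derivation[OF lr_derivation_poly_deriv]
  have "?Q = 0"
  proof (rule poly_eq_0_by_poly_deriv)
    show "poly_deriv scale ?Q = 0"
      unfolding additive.diff[OF additive_poly_deriv] poly_deriv_add D by (simp add: add_ac)
    show "coeff ?Q 0 = 0" by (simp add: coeff_0_Lambda_poly)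
    show "coeff ?Q n = 0" if "n \<ge> p" for n
      by (simp only: coeff_add coeff_diff coeff_Lambda_poly_right[OF that]) simp
  qed
  then have "eval_one ?Q = 0" by simp
  then have "Lambda br z (y + x) + Lambda br y x - (Lambda br z y + Lambda br (z + y) x) = 0"
    unfolding additive.diff[OF additive_eval_one] eval_one_add eval_one_Lambda_poly by simp
  then show ?thesis by simp
qed

text \<open>
  The argument is the one for the cocycle identity, with \<open>t\<close> now in the first argument as well.
\<close>

lemma Lambda_commute: "Lambda br x y = Lambda br y x"
proof -
  interpret P: lie_rinehart "poly_ext scale" p "poly_ext act" "poly_ext br" by (rule lie_rinehart_poly)
  let ?Q = "Lambda_poly [:0, x:] [:y:] - Lambda_poly [:y:] [:0, x:]"
  note D = P.Lambda_derivation[OF lr_derivation_poly_deriv]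
  have "?Q = 0"
  proof (rule poly_eq_0_by_poly_deriv)
    show "poly_deriv scale ?Q = 0"
      unfolding additive.diff[OF additive_poly_deriv] D by (simp add: add_ac)
    show "coeff ?Q 0 = 0" by (simp add: coeff_0_Lambda_poly)
    show "coeff ?Q n = 0" if "n \<ge> p" for n
      by (simp only: coeff_diff coeff_Lambda_poly_right[OF that] coeff_Lambda_poly_left[OF that]) simp
  qed
  then have "eval_one ?Q = 0" by simp
  then show ?thesis
    unfolding additive.diff[OF additive_eval_one] eval_one_Lambda_poly by simp
qed

end

section \<open>p-maps on free modules\<close>

lemma (in char_p) freshman: "(a + b :: 'a) ^ p = a ^ p + b ^ p"
proof -
  have dvd: "CHAR('a) dvd p" using p_zero by (simp only: of_nat_eq_0_iff_char_dvd)
  have "CHAR('a) \<noteq> 1"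
  proof
    assume "CHAR('a) = 1"
    then have "(of_nat 1 :: 'a) = 0" using of_nat_CHAR[where ?'a = 'a] by (simp only:)
    then show False by simp
  qed
  then have "CHAR('a) = p" using p_prime dvd unfolding prime_nat_iff by blast
  with p_prime show ?thesis by (intro freshmans_dream) (simp_all only:)
qed

definition fscale :: "'a::comm_ring_1 \<Rightarrow> ('j \<Rightarrow>\<^sub>0 'a) \<Rightarrow> ('j \<Rightarrow>\<^sub>0 'a)" where
  "fscale a u = Poly_Mapping.map ((*) a) u"

abbreviation unit_vec :: "'j \<Rightarrow> ('j \<Rightarrow>\<^sub>0 'a::comm_ring_1)" where
  "unit_vec j \<equiv> Poly_Mapping.single j 1"

lemma lookup_map_0: "f 0 = 0 \<Longrightarrow> Poly_Mapping.lookup (Poly_Mapping.map f u) j = f (Poly_Mapping.lookup u j)"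
  by (auto simp: Poly_Mapping.map.rep_eq when_def)

lemma lookup_fscale [simp]: "Poly_Mapping.lookup (fscale a u) j = a * Poly_Mapping.lookup u j"
  by (simp add: fscale_def lookup_map_0)

lemma module_fscale: "module fscale"
  by unfold_locales (auto intro!: poly_mapping_eqI simp: lookup_add algebra_simps)

lemmas fscale_simps = module.scale_right_distrib[OF module_fscale] module.scale_left_distrib[OF module_fscale]
  module.scale_scale[OF module_fscale] module.scale_one[OF module_fscale]
  module.scale_zero_right[OF module_fscale] module.scale_zero_left[OF module_fscale]
  module.scale_minus_right[OF module_fscale] module.scale_minus_left[OF module_fscale]
  module.scale_right_diff_distrib[OF module_fscale] module.scale_left_diff_distrib[OF module_fscale]

lemma fscale_unit_vec: "fscale a (unit_vec j) = Poly_Mapping.single j a"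
  by (rule poly_mapping_eqI) (simp add: lookup_single when_def)

lemma poly_mapping_eq_sum:
  assumes "finite S" "Poly_Mapping.keys u \<subseteq> S"
  shows "u = (\<Sum>j\<in>S. Poly_Mapping.single j (Poly_Mapping.lookup u j))"
proof (rule poly_mapping_eqI)
  fix k
  show "Poly_Mapping.lookup u k =
      Poly_Mapping.lookup (\<Sum>j\<in>S. Poly_Mapping.single j (Poly_Mapping.lookup u j)) k"
    using assms by (auto simp: lookup_sum lookup_single when_def in_keys_iff)
qed

lemma free_module_induct:
  assumes "\<And>j. P (unit_vec j)" "\<And>a u. P u \<Longrightarrow> P (fscale a u)" "\<And>u v. P u \<Longrightarrow> P v \<Longrightarrow> P (u + v)"
  shows "P (u :: 'j \<Rightarrow>\<^sub>0 'a::comm_ring_1)"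
proof -
  have s: "P (Poly_Mapping.single j a)" for j a
    using assms(2)[OF assms(1), of a j] by (simp add: fscale_unit_vec)
  have "P (\<Sum>j\<in>S. Poly_Mapping.single j (Poly_Mapping.lookup u j))" if "finite S" for S
    using that s[of undefined 0] by induction (simp_all add: s assms(3))
  from this[of "Poly_Mapping.keys u"] show ?thesis
    using poly_mapping_eq_sum[of "Poly_Mapping.keys u" u] by simp
qed

lemma (in lie_rinehart) hochschild_zero [simp]: "hochschild_term 0 u = 0"
proof -
  have "((\<lambda>g. 0 * act u g) ^^ n) 0 = (0::'a)" for n by (induction n) simp_all
  then show ?thesis by (simp add: hochschild_term_def)
qed

text \<open>
  Here \<open>p - 1 \<ge> 1\<close> matters: at least one derivative falls on \<open>a\<close>.
\<close>

lemma (in lie_rinehart) hochschild_const: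
  assumes "act u a = 0" shows "hochschild_term a u = 0"
proof -
  have "((\<lambda>g. a * act u g) ^^ Suc n) a = 0" for n
    by (induction n) (simp_all add: assms)
  then show ?thesis by (metis hochschild_term_def p_Suc(3) scale_zero_left)
qed

text \<open>
  Compatibility of the rule for scalar multiples with itself on \<open>(f b) u\<close>: Hochschild's formula for
  the derivation \<open>b u\<close>.
\<close>

lemma (in lie_rinehart) hochschild_mult:
  "hochschild_term (f * b) u = f ^ p *s hochschild_term b u + hochschild_term f (b *s u)"
proof -
  let ?D = "\<lambda>g. b * act u g"
  have D: "derivation ?D" by (rule derivation_mult_left[OF act_derivation])
  have "((\<lambda>v. f * ?D v) ^^ (p - 1)) (f * b) =
      f ^ p * (?D ^^ (p - 1)) b + ((\<lambda>g. f * ?D g) ^^ (p - 1)) f * b"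
    by (rule char_p_module.hochschild[OF ring_module D derivationD(5)[OF D]]) (simp add: derivationD(2)[OF act_derivation] algebra_simps)
  then show ?thesis
    by (simp add: hochschild_term_def act_scale scale_left_distrib mult.assoc)
qed

lemma (in lie_rinehart) act_funpow_scale:
  "(act (a *s u) ^^ p) g = a ^ p * (act u ^^ p) g + act (hochschild_term a u) g"
proof -
  have S: "act (a *s u) = (\<lambda>g. a * act u g)" by (simp add: fun_eq_iff act_scale)
  have "(act (a *s u) ^^ p) g = ((\<lambda>g. a * act u g) ^^ Suc (p - 1)) g"
    unfolding S using p_Suc(1) by simp
  also have "\<dots> = ((\<lambda>g. a * act u g) ^^ (p - 1)) (a * act u g)"
    by (simp only: funpow_Suc_right comp_apply)
  also have "\<dots> = a ^ p * (act u ^^ (p - 1)) (act u g) + ((\<lambda>g. a * act u g) ^^ (p - 1)) a * act u g"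
    by (rule char_p_module.hochschild[OF ring_module act_derivation additive_act])
      (simp add: derivationD(2)[OF act_derivation] algebra_simps)
  also have "(act u ^^ (p - 1)) (act u g) = (act u ^^ Suc (p - 1)) g"
    by (simp only: funpow_Suc_right comp_apply)
  finally show ?thesis using p_Suc(1) by (simp add: hochschild_term_def act_scale S)
qed

locale restricted_lie_rinehart = lie_rinehart scale p act br
  for scale :: "'a::comm_ring_1 \<Rightarrow> 'b::ab_group_add \<Rightarrow> 'b" (infixr "*s" 75) and p act br +
  fixes P :: "'b \<Rightarrow> 'b"
  assumes P_add: "P (u + v) = P u + P v + Lambda br u v"
    and P_scale: "P (a *s u) = a ^ p *s P u + hochschild_term a u"
    and P_act: "(act u ^^ p) g = act (P u) g"

locale free_lie_rinehart = lie_rinehart fscale p act br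
  for p :: nat and act :: "('j \<Rightarrow>\<^sub>0 'a::comm_ring_1) \<Rightarrow> 'a \<Rightarrow> 'a"
    and br :: "('j \<Rightarrow>\<^sub>0 'a) \<Rightarrow> ('j \<Rightarrow>\<^sub>0 'a) \<Rightarrow> ('j \<Rightarrow>\<^sub>0 'a)"
begin

text \<open>
  The extension of the module by itself with cocycle \<open>Lambda\<close>. Maps that satisfy the sum rule of a
  p-map are the additive sections of its first projection.
\<close>

definition oplus :: "('j \<Rightarrow>\<^sub>0 'a) \<times> ('j \<Rightarrow>\<^sub>0 'a) \<Rightarrow> ('j \<Rightarrow>\<^sub>0 'a) \<times> ('j \<Rightarrow>\<^sub>0 'a) \<Rightarrow> ('j \<Rightarrow>\<^sub>0 'a) \<times> ('j \<Rightarrow>\<^sub>0 'a)" where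
  "oplus X Y = (fst X + fst Y, snd X + snd Y + Lambda br (fst X) (fst Y))"

sublocale E: comm_monoid_set oplus "(0, 0)"
proof
  fix X Y Z
  show "oplus (oplus X Y) Z = oplus X (oplus Y Z)"
    using Lambda_cocycle[of "fst X" "fst Y" "fst Z"] by (simp add: oplus_def algebra_simps)
  show "oplus X Y = oplus Y X"
    by (simp add: oplus_def Lambda_commute add_ac)
  show "oplus X (0, 0) = X"
    by (simp add: oplus_def)
qed

text \<open>
  The pairs \<open>(a e_j, P (a e_j))\<close> required by the rule for scalar multiples if \<open>P e_j = q j\<close>.
\<close>

definition lift_term :: "('j \<Rightarrow> ('j \<Rightarrow>\<^sub>0 'a)) \<Rightarrow> ('j \<Rightarrow>\<^sub>0 'a) \<Rightarrow> 'j \<Rightarrow> ('j \<Rightarrow>\<^sub>0 'a) \<times> ('j \<Rightarrow>\<^sub>0 'a)" where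
  "lift_term q u j = (let a = Poly_Mapping.lookup u j in
     (fscale a (unit_vec j), fscale (a ^ p) (q j) + hochschild_term a (unit_vec j)))"

definition extended_pmap :: "('j \<Rightarrow> ('j \<Rightarrow>\<^sub>0 'a)) \<Rightarrow> ('j \<Rightarrow>\<^sub>0 'a) \<Rightarrow> ('j \<Rightarrow>\<^sub>0 'a)" where
  "extended_pmap q u = snd (E.F (lift_term q u) (Poly_Mapping.keys u))"

lemma lift_superset:
  assumes "finite S" "Poly_Mapping.keys u \<subseteq> S"
  shows "E.F (lift_term q u) S = (u, extended_pmap q u)"
proof -
  have "E.F (lift_term q u) S = E.F (lift_term q u) (Poly_Mapping.keys u)"
    using assms p_Suc(1)
    by (intro E.mono_neutral_right) (auto simp: lift_term_def in_keys_iff power_0_left)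
  moreover have "fst (E.F (lift_term q u) S) = (\<Sum>j\<in>S. Poly_Mapping.single j (Poly_Mapping.lookup u j))"
    using assms(1) by induction (simp_all add: oplus_def lift_term_def fscale_unit_vec Let_def)
  ultimately show ?thesis
    using poly_mapping_eq_sum[OF assms, symmetric] by (simp add: extended_pmap_def prod_eq_iff)
qed

lemma lift_term_add: "lift_term q (u + v) j = oplus (lift_term q u j) (lift_term q v j)"
  by (simp add: lift_term_def oplus_def Let_def lookup_add hochschild_add_left freshman scale_left_distrib)

lemma extended_pmap_add: "extended_pmap q (u + v) = extended_pmap q u + extended_pmap q v + Lambda br u v"
proof -
  let ?S = "Poly_Mapping.keys u \<union> Poly_Mapping.keys v"
  have "(u + v, extended_pmap q (u + v)) = E.F (lift_term q (u + v)) ?S"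
    by (rule lift_superset[symmetric]) (auto dest: subsetD[OF Poly_Mapping.keys_add])
  also have "\<dots> = oplus (E.F (lift_term q u) ?S) (E.F (lift_term q v) ?S)"
    unfolding lift_term_add by (rule E.distrib)
  also have "\<dots> = oplus (u, extended_pmap q u) (v, extended_pmap q v)"
    by (simp add: lift_superset)
  finally show ?thesis by (simp add: oplus_def)
qed

lemma extended_pmap_single: "extended_pmap q (fscale a (unit_vec j)) = fscale (a ^ p) (q j) + hochschild_term a (unit_vec j)"
proof -
  have "(fscale a (unit_vec j), extended_pmap q (fscale a (unit_vec j))) = E.F (lift_term q (fscale a (unit_vec j))) {j}"
    by (rule lift_superset[symmetric]) (auto simp: fscale_unit_vec)
  then show ?thesis by (simp add: lift_term_def Let_def)
qed

lemma extended_pmap_unit_vec: "extended_pmap q (unit_vec j) = q j"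
  using extended_pmap_single[of q 1 j] hochschild_const[of "unit_vec j" 1]
  by (simp add: derivationD(4)[OF act_derivation])

lemma multiples_of_unit_vec_induct:
  assumes "\<And>f j b. Q f (fscale b (unit_vec j))" "\<And>f u v. Q f u \<Longrightarrow> Q f v \<Longrightarrow> Q f (u + v)"
  shows "Q f (u :: 'j \<Rightarrow>\<^sub>0 'a)"
proof -
  have "Q f (\<Sum>j\<in>S. fscale (Poly_Mapping.lookup u j) (unit_vec j))" if "finite S" for S
    using that assms(1)[of f 0 undefined] by induction (simp_all add: assms)
  then have "Q f (\<Sum>j\<in>Poly_Mapping.keys u. fscale (Poly_Mapping.lookup u j) (unit_vec j))" by simp
  then show ?thesis
    unfolding fscale_unit_vec using poly_mapping_eq_sum[of "Poly_Mapping.keys u" u] by simp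
qed

lemma extended_pmap_scale: "extended_pmap q (fscale f u) = fscale (f ^ p) (extended_pmap q u) + hochschild_term f u"
proof (rule multiples_of_unit_vec_induct[of "\<lambda>f u. extended_pmap q (fscale f u) = fscale (f ^ p) (extended_pmap q u) + hochschild_term f u"])
  fix f b j
  show "extended_pmap q (fscale f (fscale b (unit_vec j))) = fscale (f ^ p) (extended_pmap q (fscale b (unit_vec j))) + hochschild_term f (fscale b (unit_vec j))"
    by (simp add: extended_pmap_single hochschild_mult power_mult_distrib scale_right_distrib)
next
  fix f u v
  assume "extended_pmap q (fscale f u) = fscale (f ^ p) (extended_pmap q u) + hochschild_term f u"
    "extended_pmap q (fscale f v) = fscale (f ^ p) (extended_pmap q v) + hochschild_term f v"
  moreover have "fscale (f ^ p) (extended_pmap q (u + v)) + hochschild_term f (u + v) = fscale (f ^ p) (extended_pmap q u) +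
      fscale (f ^ p) (extended_pmap q v) + (hochschild_term f (u + v) + fscale (f ^ p) (Lambda br u v))"
    by (simp only: extended_pmap_add scale_right_distrib add_ac)
  ultimately show "extended_pmap q (fscale f (u + v)) = fscale (f ^ p) (extended_pmap q (u + v)) + hochschild_term f (u + v)"
    unfolding hochschild_add_right scale_right_distrib extended_pmap_add by (simp only: add_ac)
qed

lemma extended_pmap_act:
  assumes "\<And>j g. (act (unit_vec j) ^^ p) g = act (q j) g"
  shows "(act u ^^ p) g = act (extended_pmap q u) g"
proof (rule free_module_induct[of "\<lambda>u. (act u ^^ p) g = act (extended_pmap q u) g"])
  show "(act (unit_vec j) ^^ p) g = act (extended_pmap q (unit_vec j)) g" for j
    by (simp add: extended_pmap_unit_vec assms)
qed (simp_all add: extended_pmap_scale extended_pmap_add act_add act_scale act_funpow_scale act_Lambda)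

text \<open>
  On a free module a p-map exists with arbitrary values on the basis, as long as they act as the p-th
  powers of the basis elements.
\<close>

theorem restricted_lie_rinehart_extended_pmap:
  assumes "\<And>j g. (act (unit_vec j) ^^ p) g = act (q j) g"
  shows "restricted_lie_rinehart fscale p act br (extended_pmap q)"
  by unfold_locales (simp_all add: extended_pmap_add extended_pmap_scale extended_pmap_act[OF assms])

end

section \<open>Lie-Rinehart algebras on free modules\<close>

definition linear_ext :: "('c::zero \<Rightarrow> 'd \<Rightarrow> 'e::ab_group_add) \<Rightarrow> ('j \<Rightarrow> 'd) \<Rightarrow> ('j \<Rightarrow>\<^sub>0 'c) \<Rightarrow> 'e" where
  "linear_ext s \<phi> u = (\<Sum>j\<in>Poly_Mapping.keys u. s (Poly_Mapping.lookup u j) (\<phi> j))"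

lemma linear_ext_superset:
  assumes "\<And>x. s 0 x = 0" "finite S" "Poly_Mapping.keys u \<subseteq> S"
  shows "linear_ext s \<phi> u = (\<Sum>j\<in>S. s (Poly_Mapping.lookup u j) (\<phi> j))"
  unfolding linear_ext_def using assms by (intro sum.mono_neutral_left) (auto simp: in_keys_iff)

lemma linear_ext_add:
  fixes s :: "'c::ab_group_add \<Rightarrow> 'd \<Rightarrow> 'e::ab_group_add"
  assumes "\<And>x y z. s (x + y) z = s x z + s y z"
  shows "linear_ext s \<phi> (u + v) = linear_ext s \<phi> u + linear_ext s \<phi> v"
proof -
  let ?S = "Poly_Mapping.keys u \<union> Poly_Mapping.keys v"
  have z: "s 0 x = 0" for x using assms[of 0 0 x] by simp
  have "linear_ext s \<phi> w = (\<Sum>j\<in>?S. s (Poly_Mapping.lookup w j) (\<phi> j))" if "Poly_Mapping.keys w \<subseteq> ?S" for w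
    using that by (intro linear_ext_superset z) auto
  moreover have "Poly_Mapping.keys (u + v) \<subseteq> ?S" by (rule Poly_Mapping.keys_add)
  ultimately show ?thesis by (simp add: lookup_add assms sum.distrib)
qed

lemma linear_ext_single: "(\<And>x. s 0 x = 0) \<Longrightarrow> linear_ext s \<phi> (Poly_Mapping.single j a) = s a (\<phi> j)"
  using linear_ext_superset[of s "{j}" "Poly_Mapping.single j a" \<phi>] by simp

lemma (in module) linear_ext_scale_fscale: "linear_ext scale \<phi> (fscale a u) = a *s linear_ext scale \<phi> u"
proof -
  have "Poly_Mapping.keys (fscale a u) \<subseteq> Poly_Mapping.keys u" by (auto simp: in_keys_iff)
  then have "linear_ext scale \<phi> (fscale a u) =
      (\<Sum>j\<in>Poly_Mapping.keys u. (a * Poly_Mapping.lookup u j) *s \<phi> j)"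
    by (subst linear_ext_superset[of _ "Poly_Mapping.keys u"]) simp_all
  then show ?thesis by (simp add: linear_ext_def scale_sum_right)
qed

lemma (in module) linear_ext_unit_vec: "linear_ext scale \<phi> (unit_vec j) = \<phi> j"
  by (simp add: linear_ext_single)

lemma (in module) additive_linear_ext: "additive (linear_ext scale \<phi>)"
  by (rule additive.intro) (rule linear_ext_add, rule scale_left_distrib)

text \<open>
  Structure constants with values in the module: \<open>rho\<close> is the action of the basis elements and \<open>struct\<close>
  their brackets.
\<close>

locale lie_rinehart_presentation =
  fixes p :: nat and rho :: "'j \<Rightarrow> 'a::comm_ring_1 \<Rightarrow> 'a" and struct :: "'j \<Rightarrow> 'j \<Rightarrow> ('j \<Rightarrow>\<^sub>0 'a)"
  assumes char_p: "char_p TYPE('a) p"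
    and p_gt_2: "p > 2"
    and rho: "derivation (rho j)"
    and struct_skew: "struct i j = - struct j i"
begin

sublocale char_p p "TYPE('a)" by (rule char_p)

definition anchor :: "('j \<Rightarrow>\<^sub>0 'a) \<Rightarrow> 'a \<Rightarrow> 'a" where
  "anchor u g = linear_ext (*) (\<lambda>j. rho j g) u"

definition struct_bilinear :: "('j \<Rightarrow>\<^sub>0 'a) \<Rightarrow> ('j \<Rightarrow>\<^sub>0 'a) \<Rightarrow> ('j \<Rightarrow>\<^sub>0 'a)" where
  "struct_bilinear u v = linear_ext fscale (\<lambda>i. linear_ext fscale (struct i) v) u"

definition bracket :: "('j \<Rightarrow>\<^sub>0 'a) \<Rightarrow> ('j \<Rightarrow>\<^sub>0 'a) \<Rightarrow> ('j \<Rightarrow>\<^sub>0 'a)" where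
  "bracket u v = struct_bilinear u v + Poly_Mapping.map (anchor u) v - Poly_Mapping.map (anchor v) u"

lemma anchor_add: "anchor (u + v) g = anchor u g + anchor v g"
  unfolding anchor_def by (rule linear_ext_add) (simp add: algebra_simps)

lemma anchor_scale: "anchor (fscale a u) g = a * anchor u g"
  unfolding anchor_def by (rule module.linear_ext_scale_fscale[OF module_mult])

lemma anchor_unit_vec [simp]: "anchor (unit_vec j) g = rho j g"
  unfolding anchor_def by (rule module.linear_ext_unit_vec[OF module_mult])

lemma anchor_derivation: "derivation (anchor u)"
  unfolding derivation_def
proof (intro conjI allI)
  show "additive (anchor u)"
    by (rule additive.intro) (simp add: anchor_def linear_ext_def derivationD[OF rho] distrib_left sum.distrib)
  show "anchor u (f * g) = f * anchor u g + g * anchor u f" for f g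
    by (simp add: anchor_def linear_ext_def derivationD(2)[OF rho] sum.distrib[symmetric] sum_distrib_left algebra_simps)
qed

lemma anchor_0 [simp]: "anchor u 0 = 0" "anchor 0 g = 0"
  using anchor_add[of 0 0 g] by (simp_all add: derivationD(3)[OF anchor_derivation])

lemma lookup_map_anchor [simp]:
  "Poly_Mapping.lookup (Poly_Mapping.map (anchor u) v) j = anchor u (Poly_Mapping.lookup v j)"
  by (simp add: lookup_map_0)

lemma map_anchor_simps:
  "Poly_Mapping.map (anchor u) (v + w) = Poly_Mapping.map (anchor u) v + Poly_Mapping.map (anchor u) w"
  "Poly_Mapping.map (anchor (u + w)) v = Poly_Mapping.map (anchor u) v + Poly_Mapping.map (anchor w) v"
  "Poly_Mapping.map (anchor u) (fscale a v) = fscale (anchor u a) v + fscale a (Poly_Mapping.map (anchor u) v)"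
  "Poly_Mapping.map (anchor (fscale a u)) v = fscale a (Poly_Mapping.map (anchor u) v)"
  "Poly_Mapping.map (anchor u) (unit_vec j) = 0"
  by (auto intro!: poly_mapping_eqI simp: lookup_add anchor_add anchor_scale derivationD[OF anchor_derivation]
      lookup_single when_def algebra_simps)

lemma struct_bilinear_add: "struct_bilinear (u + w) v = struct_bilinear u v + struct_bilinear w v" "struct_bilinear u (v + w) = struct_bilinear u v + struct_bilinear u w"
proof -
  show "struct_bilinear (u + w) v = struct_bilinear u v + struct_bilinear w v"
    unfolding struct_bilinear_def by (rule additive.add[OF module.additive_linear_ext[OF module_fscale]])
  show "struct_bilinear u (v + w) = struct_bilinear u v + struct_bilinear u w"
    unfolding struct_bilinear_def additive.add[OF module.additive_linear_ext[OF module_fscale]]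
    by (simp add: linear_ext_def fscale_simps sum.distrib)
qed

lemma struct_bilinear_scale: "struct_bilinear (fscale a u) v = fscale a (struct_bilinear u v)" "struct_bilinear u (fscale a v) = fscale a (struct_bilinear u v)"
  unfolding struct_bilinear_def module.linear_ext_scale_fscale[OF module_fscale]
  by (simp_all add: linear_ext_def fscale_simps module.scale_sum_right[OF module_fscale] mult.left_commute)

lemma struct_bilinear_unit_vec: "struct_bilinear (unit_vec i) (unit_vec j) = struct i j"
  by (simp add: struct_bilinear_def module.linear_ext_unit_vec[OF module_fscale])

lemma struct_bilinear_skew: "struct_bilinear u v = - struct_bilinear v u"
proof (rule free_module_induct[of "\<lambda>u. struct_bilinear u v = - struct_bilinear v u"])
  fix i
  show "struct_bilinear (unit_vec i) v = - struct_bilinear v (unit_vec i)"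
    by (rule free_module_induct[of "\<lambda>v. struct_bilinear (unit_vec i) v = - struct_bilinear v (unit_vec i)"])
      (simp_all add: struct_bilinear_add struct_bilinear_scale fscale_simps struct_bilinear_unit_vec struct_skew[of i])
qed (simp_all add: struct_bilinear_add struct_bilinear_scale fscale_simps)

lemma bracket_add: "bracket u (v + w) = bracket u v + bracket u w"
  by (simp add: bracket_def struct_bilinear_add map_anchor_simps)

lemma bracket_skew: "bracket u v = - bracket v u"
  using struct_bilinear_skew[of u v] by (simp add: bracket_def)

lemma bracket_self: "bracket u u = 0"
proof -
  have "struct_bilinear u u + struct_bilinear u u = 0" using struct_bilinear_skew[of u u] by (simp add: eq_neg_iff_add_eq_0)
  then have "fscale 2 (struct_bilinear u u) = 0"
    by (metis fscale_simps(2) module.scale_one[OF module_fscale] one_add_one)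
  then have "fscale (inv_nat 2 * 2) (struct_bilinear u u) = 0" by (simp add: fscale_simps flip: fscale_simps(3))
  moreover have "inv_nat 2 * 2 = (1 :: 'a)"
    using inv_nat[of 2] p_gt_2 by (simp add: mult.commute)
  ultimately show ?thesis
    by (simp add: bracket_def module.scale_one[OF module_fscale])
qed

lemma bracket_scale: "bracket u (fscale a v) = fscale (anchor u a) v + fscale a (bracket u v)"
  by (simp add: bracket_def struct_bilinear_scale map_anchor_simps fscale_simps)

lemma bracket_unit_vec: "bracket (unit_vec i) (unit_vec j) = struct i j"
  by (simp add: bracket_def struct_bilinear_unit_vec map_anchor_simps)

lemma bracket_add_left: "bracket (v + w) u = bracket v u + bracket w u"
  by (metis bracket_skew bracket_add minus_add_distrib)

lemma bracket_minus: "bracket u (- v) = - bracket u v"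
  using additive.minus[of "bracket u" v] by (simp add: additive_def bracket_add)

lemma anchor_minus: "anchor (- u) g = - anchor u g"
  using additive.minus[of "\<lambda>u. anchor u g" u] by (simp add: additive_def anchor_add)

lemma anchor_diff: "anchor (u - v) g = anchor u g - anchor v g"
  unfolding diff_conv_add_uminus anchor_add anchor_minus ..

definition jacobiator :: "('j \<Rightarrow>\<^sub>0 'a) \<Rightarrow> ('j \<Rightarrow>\<^sub>0 'a) \<Rightarrow> ('j \<Rightarrow>\<^sub>0 'a) \<Rightarrow> ('j \<Rightarrow>\<^sub>0 'a)" where
  "jacobiator u v w = bracket u (bracket v w) + bracket v (bracket w u) + bracket w (bracket u v)"

lemma jacobiator_cyclic: "jacobiator u v w = jacobiator w u v"
  by (simp add: jacobiator_def add_ac)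

lemma jacobiator_add: "jacobiator u v (w + w') = jacobiator u v w + jacobiator u v w'"
  by (simp add: jacobiator_def bracket_add bracket_add_left)

text \<open>
  The defects of both axioms, the Jacobi identity and the compatibility of the action with brackets, are
  linear over the ring, so that it suffices to test them on the basis. For the Jacobi identity this
  depends on the compatibility of the action.
\<close>

lemma lie_rinehart_from_presentation:
  assumes act_unit_vec: "\<And>i j g. anchor (struct i j) g = rho i (rho j g) - rho j (rho i g)"
    and jacobiator_unit_vec: "\<And>i j k. jacobiator (unit_vec i) (unit_vec j) (unit_vec k) = 0"
  shows "lie_rinehart fscale p anchor bracket"
proof -
  have act_br: "anchor (bracket u v) g = anchor u (anchor v g) - anchor v (anchor u g)" for u v g
  proof (rule free_module_induct[of "\<lambda>v. anchor (bracket u v) g = anchor u (anchor v g) - anchor v (anchor u g)"])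
    fix j
    show "anchor (bracket u (unit_vec j)) g = anchor u (anchor (unit_vec j) g) - anchor (unit_vec j) (anchor u g)"
    proof (rule free_module_induct[of "\<lambda>u. anchor (bracket u (unit_vec j)) g = anchor u (anchor (unit_vec j) g) - anchor (unit_vec j) (anchor u g)"])
      show "anchor (bracket (fscale a u) (unit_vec j)) g = anchor (fscale a u) (anchor (unit_vec j) g) - anchor (unit_vec j) (anchor (fscale a u) g)"
        if "anchor (bracket u (unit_vec j)) g = anchor u (anchor (unit_vec j) g) - anchor (unit_vec j) (anchor u g)" for a u
        using that unfolding bracket_skew[of _ "unit_vec j"]
        by (simp add: bracket_scale anchor_scale anchor_add anchor_minus anchor_diff derivationD[OF rho] algebra_simps)
    qed (simp_all add: bracket_unit_vec act_unit_vec bracket_add_left anchor_add derivationD[OF rho])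
  next
    fix a v
    assume IH: "anchor (bracket u v) g = anchor u (anchor v g) - anchor v (anchor u g)"
    show "anchor (bracket u (fscale a v)) g = anchor u (anchor (fscale a v) g) - anchor (fscale a v) (anchor u g)"
      by (simp only: bracket_scale anchor_add anchor_scale IH derivationD(2)[OF anchor_derivation])
        (simp add: algebra_simps)
  qed (simp_all add: bracket_add anchor_add derivationD[OF anchor_derivation])
  have jacobiator_scale: "jacobiator u v (fscale a w) = fscale a (jacobiator u v w)" for u v w a
  proof -
    have 1: "bracket u (bracket v (fscale a w)) = fscale (anchor u (anchor v a)) w + fscale (anchor v a) (bracket u w) +
        fscale (anchor u a) (bracket v w) + fscale a (bracket u (bracket v w))" for u v
      by (simp add: bracket_scale bracket_add add_ac)
    have 2: "bracket v (bracket (fscale a w) u) = - bracket v (bracket u (fscale a w))"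
      unfolding bracket_skew[of "fscale a w" u] bracket_minus ..
    have 3: "bracket (fscale a w) (bracket u v) = - fscale (anchor u (anchor v a) - anchor v (anchor u a)) w
        - fscale a (bracket (bracket u v) w)"
      unfolding bracket_skew[of "fscale a w"] bracket_scale act_br by simp
    have 4: "bracket v (bracket w u) = - bracket v (bracket u w)" "bracket w (bracket u v) = - bracket (bracket u v) w"
      using bracket_skew[of w u] bracket_skew[of w "bracket u v"] by (simp_all add: bracket_minus)
    show ?thesis
      unfolding jacobiator_def 1 2 3 4 by (simp add: fscale_simps)
  qed
  have j1: "jacobiator (unit_vec i) (unit_vec j) w = 0" for i j w
    by (rule free_module_induct[of "\<lambda>w. jacobiator (unit_vec i) (unit_vec j) w = 0"])
      (simp_all add: jacobiator_unit_vec jacobiator_scale jacobiator_add fscale_simps)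
  have j2: "jacobiator w (unit_vec i) v = 0" for i v w
  proof (rule free_module_induct[of "\<lambda>v. jacobiator w (unit_vec i) v = 0"])
    show "jacobiator w (unit_vec i) (unit_vec j) = 0" for j
      using jacobiator_cyclic[of "unit_vec i" "unit_vec j" w] j1[of i j w] by simp
  qed (simp_all add: jacobiator_scale jacobiator_add fscale_simps)
  have j3: "jacobiator v w u = 0" for u v w
  proof (rule free_module_induct[of "\<lambda>u. jacobiator v w u = 0"])
    show "jacobiator v w (unit_vec i) = 0" for i
      using jacobiator_cyclic[of v w "unit_vec i"] jacobiator_cyclic[of "unit_vec i" v w] j2[of w i v] by simp
  qed (simp_all add: jacobiator_scale jacobiator_add fscale_simps)
  have jacobi: "bracket u (bracket v w) = bracket (bracket u v) w + bracket v (bracket u w)" for u v w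
    using j3[of u v w] bracket_skew[of w u] bracket_skew[of w "bracket u v"]
    by (simp add: jacobiator_def bracket_minus algebra_simps)
  show ?thesis
    by (intro lie_rinehart.intro char_p_module.intro lie_rinehart_axioms.intro module_fscale char_p_axioms
        anchor_add anchor_scale anchor_derivation bracket_add bracket_skew bracket_self bracket_scale act_br jacobi)
qed

end

section \<open>Derivations of polynomial rings\<close>

abbreviation const :: "'k::field \<Rightarrow> ('i, 'k) mpol" where
  "const c \<equiv> Poly_Mapping.single 0 c"

abbreviation monomial :: "('i \<Rightarrow>\<^sub>0 nat) \<Rightarrow> ('i, 'k::field) mpol" where
  "monomial m \<equiv> Poly_Mapping.single m 1"

lemma poly_mapping_single_induct:
  assumes "\<And>m c. P (Poly_Mapping.single m c)" "\<And>f g. P f \<Longrightarrow> P g \<Longrightarrow> P (f + g)"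
  shows "P (f :: 'm \<Rightarrow>\<^sub>0 'c::comm_ring_1)"
proof -
  have "P (\<Sum>j\<in>S. Poly_Mapping.single j (Poly_Mapping.lookup f j))" if "finite S" for S
    using that assms(1)[of undefined 0] by induction (simp_all add: assms)
  from this[of "Poly_Mapping.keys f"] show ?thesis
    using poly_mapping_eq_sum[of "Poly_Mapping.keys f" f] by simp
qed

definition dmon :: "(('i, 'k::field) mpol \<Rightarrow> 'b::ab_group_add \<Rightarrow> 'b) \<Rightarrow> ('i \<Rightarrow> 'b) \<Rightarrow> ('i \<Rightarrow>\<^sub>0 nat) \<Rightarrow> 'b" where
  "dmon s \<phi> m = (\<Sum>i\<in>Poly_Mapping.keys m.
     s (of_nat (Poly_Mapping.lookup m i) * monomial (m - Poly_Mapping.single i 1)) (\<phi> i))"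

text \<open>
  The derivation with values in a module that sends the variable \<open>i\<close> to \<open>\<phi> i\<close>. Values in the ring
  give vector fields, values in a free module give jets.
\<close>

definition der :: "(('i, 'k::field) mpol \<Rightarrow> 'b::ab_group_add \<Rightarrow> 'b) \<Rightarrow> ('i \<Rightarrow> 'b) \<Rightarrow> ('i, 'k) mpol \<Rightarrow> 'b" where
  "der s \<phi> f = linear_ext (\<lambda>c. s (const c)) (dmon s \<phi>) f"

lemma mono_shift:
  fixes m n :: "'i \<Rightarrow>\<^sub>0 nat"
  assumes "Poly_Mapping.lookup m i \<noteq> 0"
  shows "m + n - Poly_Mapping.single i 1 = n + (m - Poly_Mapping.single i 1)"
  by (rule poly_mapping_eqI) (use assms in \<open>auto simp: lookup_add lookup_minus lookup_single when_def\<close>)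

context
  fixes s :: "('i, 'k::field) mpol \<Rightarrow> 'b::ab_group_add \<Rightarrow> 'b"
  assumes s: "module s"
begin

interpretation module s by (rule s)

lemma dmon_superset:
  assumes "finite S" "Poly_Mapping.keys m \<subseteq> S"
  shows "dmon s \<phi> m = (\<Sum>i\<in>S. s (of_nat (Poly_Mapping.lookup m i) * monomial (m - Poly_Mapping.single i 1)) (\<phi> i))"
  unfolding dmon_def using assms by (intro sum.mono_neutral_left) (auto simp: in_keys_iff)

lemma dmon_add: "dmon s \<phi> (m + n) = s (monomial n) (dmon s \<phi> m) + s (monomial m) (dmon s \<phi> n)"
proof -
  let ?S = "Poly_Mapping.keys m \<union> Poly_Mapping.keys n"
  let ?t = "\<lambda>m i. of_nat (Poly_Mapping.lookup m i) * monomial (m - Poly_Mapping.single i 1) :: ('i, 'k) mpol"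
  have key: "monomial m' * ?t n' i = of_nat (Poly_Mapping.lookup n' i) * monomial (n' + m' - Poly_Mapping.single i 1)" for m' n' i
  proof (cases "Poly_Mapping.lookup n' i = 0")
    case False
    have "monomial m' * (monomial (n' - Poly_Mapping.single i 1) :: ('i, 'k) mpol) = monomial (n' + m' - Poly_Mapping.single i 1)"
      unfolding mono_shift[OF False] by (simp add: mult_single)
    then show ?thesis by (subst mult.left_commute) (simp only:)
  qed simp
  have t: "?t (m + n) i = monomial n * ?t m i + monomial m * ?t n i" for i
    unfolding key by (simp add: lookup_add distrib_right add.commute[of n m])
  have "dmon s \<phi> (m + n) = (\<Sum>i\<in>?S. s (?t (m + n) i) (\<phi> i))"
    by (rule dmon_superset) (auto dest: subsetD[OF Poly_Mapping.keys_add])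
  also have "\<dots> =
      s (monomial n) (\<Sum>i\<in>?S. s (?t m i) (\<phi> i)) + s (monomial m) (\<Sum>i\<in>?S. s (?t n i) (\<phi> i))"
    unfolding t by (simp add: scale_left_distrib sum.distrib scale_sum_right)
  finally show ?thesis by (simp add: dmon_superset[of ?S])
qed

lemma der_add: "der s \<phi> (f + g) = der s \<phi> f + der s \<phi> g"
  unfolding der_def by (rule linear_ext_add) (simp add: single_add scale_left_distrib)

lemma der_single: "der s \<phi> (Poly_Mapping.single m c) = s (const c) (dmon s \<phi> m)"
  unfolding der_def by (rule linear_ext_single) simp

lemma der_mult: "der s \<phi> (f * g) = s f (der s \<phi> g) + s g (der s \<phi> f)"
proof (rule poly_mapping_single_induct[of "\<lambda>f. der s \<phi> (f * g) = s f (der s \<phi> g) + s g (der s \<phi> f)"])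
  fix m :: "'i \<Rightarrow>\<^sub>0 nat" and c :: 'k
  show "der s \<phi> (Poly_Mapping.single m c * g) =
      s (Poly_Mapping.single m c) (der s \<phi> g) + s g (der s \<phi> (Poly_Mapping.single m c))"
    by (rule poly_mapping_single_induct[of "\<lambda>g. der s \<phi> (Poly_Mapping.single m c * g) =
        s (Poly_Mapping.single m c) (der s \<phi> g) + s g (der s \<phi> (Poly_Mapping.single m c))"])
      (simp_all add: mult_single der_single dmon_add scale_right_distrib ac_simps,
       simp_all add: der_add distrib_left distrib_right scale_right_distrib scale_left_distrib)
qed (simp_all add: der_add distrib_right scale_right_distrib scale_left_distrib)

lemma der_const: "der s \<phi> (const c) = 0"
  by (simp add: der_single dmon_def)

lemma der_var: "der s \<phi> (mpoly_var i) = \<phi> i"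
  by (simp add: mpoly_var_def der_single dmon_def)

end

lemma const_mult: "const c * const d = const (c * d :: 'k::field)"
  by (simp add: mult_single)

lemma const_power: "const c ^ n = const (c ^ n :: 'k::field)"
  by (induction n) (simp_all add: const_mult)

lemma mono_mpolys_induct:
  fixes m :: "'i \<Rightarrow>\<^sub>0 nat"
  assumes "P 0" "\<And>m i. Poly_Mapping.keys m \<subseteq> T \<Longrightarrow> i \<in> T \<Longrightarrow> P m \<Longrightarrow> P (m + Poly_Mapping.single i 1)"
    and "Poly_Mapping.keys m \<subseteq> T"
  shows "P m"
  using assms(3)
proof (induction "sum (Poly_Mapping.lookup m) (Poly_Mapping.keys m)" arbitrary: m rule: less_induct)
  case less
  show ?case
  proof (cases "m = 0")
    case True
    then show ?thesis using assms(1) by simp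
  next
    case False
    then obtain i where i: "i \<in> Poly_Mapping.keys m"
      by (metis all_not_in_conv keys_eq_empty)
    let ?n = "m - Poly_Mapping.single i 1"
    have m: "m = ?n + Poly_Mapping.single i 1"
      using i by (intro poly_mapping_eqI) (auto simp: lookup_add lookup_minus lookup_single when_def in_keys_iff)
    have keys: "Poly_Mapping.keys ?n \<subseteq> Poly_Mapping.keys m"
      by (auto simp: in_keys_iff lookup_minus)
    have "sum (Poly_Mapping.lookup ?n) (Poly_Mapping.keys ?n) = sum (Poly_Mapping.lookup ?n) (Poly_Mapping.keys m)"
      using keys by (intro sum.mono_neutral_left) (auto simp: in_keys_iff)
    also have "\<dots> < sum (Poly_Mapping.lookup m) (Poly_Mapping.keys m)"
      using i by (intro sum_strict_mono_ex1) (auto simp: lookup_minus lookup_single when_def in_keys_iff intro!: bexI[of _ i])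
    finally have "P ?n" using less keys by blast
    then show ?thesis using assms(2)[of ?n i] keys less.prems i m by auto
  qed
qed

lemma mpolys_const: "const c \<in> mpolys T"
  by (auto simp: mpolys_def)

lemma mpolys_var: "i \<in> T \<Longrightarrow> mpoly_var i \<in> mpolys T"
  by (auto simp: mpolys_def mpoly_var_def)

lemma mpolys_add: "f \<in> mpolys T \<Longrightarrow> g \<in> mpolys T \<Longrightarrow> f + g \<in> mpolys T"
  using Poly_Mapping.keys_add[of f g] by (auto simp: mpolys_def)

lemma mpolys_mult: "f \<in> mpolys T \<Longrightarrow> g \<in> mpolys T \<Longrightarrow> f * g \<in> mpolys T"
proof -
  assume f: "f \<in> mpolys T" and g: "g \<in> mpolys T"
  show ?thesis
    unfolding mpolys_def
  proof (intro CollectI ballI)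
    fix m assume "m \<in> Poly_Mapping.keys (f * g)"
    then obtain a b where "m = a + b" "a \<in> Poly_Mapping.keys f" "b \<in> Poly_Mapping.keys g"
      using Poly_Mapping.keys_mult[of f g] by auto
    moreover from this f g have "Poly_Mapping.keys a \<subseteq> T" "Poly_Mapping.keys b \<subseteq> T"
      by (auto simp: mpolys_def)
    ultimately show "Poly_Mapping.keys m \<subseteq> T"
      using Poly_Mapping.keys_add[of a b] by blast
  qed
qed

text \<open>
  Generation of the polynomial algebra by constants and variables.
\<close>

lemma mpolys_induct [consumes 1, case_names const var add mult]:
  fixes f :: "('i, 'k::field) mpol"
  assumes f: "f \<in> mpolys T"
    and const: "\<And>c. P (const c)"
    and var: "\<And>i. i \<in> T \<Longrightarrow> P (mpoly_var i)"
    and add: "\<And>f g. f \<in> mpolys T \<Longrightarrow> g \<in> mpolys T \<Longrightarrow> P f \<Longrightarrow> P g \<Longrightarrow> P (f + g)"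
    and mult: "\<And>f g. f \<in> mpolys T \<Longrightarrow> g \<in> mpolys T \<Longrightarrow> P f \<Longrightarrow> P g \<Longrightarrow> P (f * g)"
  shows "P f"
proof -
  have mono: "P (monomial m) \<and> monomial m \<in> (mpolys T :: ('i, 'k) mpol set)" if "Poly_Mapping.keys m \<subseteq> T" for m
  proof (rule mono_mpolys_induct[OF _ _ that])
    show "P (monomial 0) \<and> monomial 0 \<in> (mpolys T :: ('i, 'k) mpol set)"
      using const mpolys_const by blast
    fix m :: "'i \<Rightarrow>\<^sub>0 nat" and i
    assume IH: "P (monomial m) \<and> monomial m \<in> (mpolys T :: ('i, 'k) mpol set)" and i: "i \<in> T"
    have e: "monomial (m + Poly_Mapping.single i 1) = monomial m * (mpoly_var i :: ('i, 'k) mpol)"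
      by (simp add: mpoly_var_def mult_single)
    show "P (monomial (m + Poly_Mapping.single i 1)) \<and>
        monomial (m + Poly_Mapping.single i 1) \<in> (mpolys T :: ('i, 'k) mpol set)"
      unfolding e using IH i by (auto intro: mult var mpolys_mult mpolys_var)
  qed
  have single: "P (Poly_Mapping.single m c) \<and> Poly_Mapping.single m c \<in> mpolys T"
    if "Poly_Mapping.keys m \<subseteq> T" for m and c :: 'k
  proof -
    have "Poly_Mapping.single m c = const c * monomial m" by (simp add: mult_single)
    then show ?thesis using mono[OF that] by (auto intro: mult const mpolys_mult mpolys_const)
  qed
  have "P (\<Sum>m\<in>S. Poly_Mapping.single m (Poly_Mapping.lookup f m)) \<and>
      (\<Sum>m\<in>S. Poly_Mapping.single m (Poly_Mapping.lookup f m)) \<in> mpolys T"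
    if "finite S" "S \<subseteq> Poly_Mapping.keys f" for S
    using that
  proof (induction S)
    case empty
    show ?case using const[of 0] mpolys_const[of 0 T] by simp
  next
    case (insert m S)
    then have "Poly_Mapping.keys m \<subseteq> T" using f by (auto simp: mpolys_def)
    then show ?case using insert single[of m "Poly_Mapping.lookup f m"]
      by (simp add: add mpolys_add)
  qed
  from this[of "Poly_Mapping.keys f"] show ?thesis
    unfolding poly_mapping_eq_sum[OF finite_keys order_refl, symmetric] by simp
qed

lemma mpolys_UNIV: "f \<in> mpolys UNIV"
  by (simp add: mpolys_def)

lemma derivation_funpow_mult:
  assumes D: "derivation D"
  shows "(D ^^ n) (f * g) = (\<Sum>k\<le>n. of_nat (n choose k) * (D ^^ k) f * (D ^^ (n - k)) g)"
proof (induction n)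
  case 0
  show ?case by simp
next
  case (Suc n)
  have "(D ^^ Suc n) (f * g) = (\<Sum>k\<le>n. of_nat (n choose k) * (D ^^ Suc k) f * (D ^^ (n - k)) g) +
      (\<Sum>k\<le>n. of_nat (n choose k) * (D ^^ k) f * (D ^^ (Suc n - k)) g)"
    unfolding sum.distrib[symmetric]
    by (simp add: Suc.IH derivationD[OF D] Suc_diff_le)
      (intro sum.cong refl, simp add: algebra_simps)
  also have "(\<Sum>k\<le>n. of_nat (n choose k) * (D ^^ k) f * (D ^^ (Suc n - k)) g) =
      (\<Sum>k\<le>Suc n. of_nat (n choose k) * (D ^^ k) f * (D ^^ (Suc n - k)) g)"
    by (simp add: binomial_eq_0)
  also have "\<dots> = (D ^^ Suc n) g * f +
      (\<Sum>k\<le>n. of_nat (n choose Suc k) * (D ^^ Suc k) f * (D ^^ (n - k)) g)"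
    by (subst sum.atMost_Suc_shift) (simp add: mult.commute)
  finally have "(D ^^ Suc n) (f * g) = (D ^^ Suc n) g * f +
      (\<Sum>k\<le>n. of_nat (Suc n choose Suc k) * (D ^^ Suc k) f * (D ^^ (n - k)) g)"
    by (simp add: sum.distrib distrib_right add_ac)
  then show ?case
    by (subst sum.atMost_Suc_shift) (simp add: mult.commute)
qed

text \<open>
  The inner binomial coefficients of Leibniz's formula vanish.
\<close>

lemma (in char_p) derivation_funpow_p:
  fixes D :: "'a \<Rightarrow> 'a"
  assumes D: "derivation D" shows "derivation (D ^^ p)"
  unfolding derivation_def
proof (intro conjI allI)
  show "additive (D ^^ p)" by (rule additive_funpow[OF derivationD(5)[OF D]])
  fix f g
  have "p \<noteq> 0" using p_prime by auto
  have "(D ^^ p) (f * g) = (\<Sum>k\<in>{0, p}. of_nat (p choose k) * (D ^^ k) f * (D ^^ (p - k)) g)"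
    unfolding derivation_funpow_mult[OF D]
    by (rule sum.mono_neutral_right) (auto simp: of_nat_choose_p)
  then show "(D ^^ p) (f * g) = f * (D ^^ p) g + g * (D ^^ p) f"
    using \<open>p \<noteq> 0\<close> by (simp add: mult.commute)
qed

section \<open>The jet algebra of a Poisson bracket\<close>

locale poisson_polynomials =
  fixes T :: "'i set" and br :: "('i, 'k::field) mpol \<Rightarrow> ('i, 'k) mpol \<Rightarrow> ('i, 'k) mpol"
    and \<gamma> :: "'i \<Rightarrow> ('i, 'k) mpol" and p :: nat
  assumes char_k: "CHAR('k) = p" and p_gt_2: "p \<ge> 3"
    and poisson: "poisson_algebra mpoly_scale (mpolys T) br"
    and \<gamma>_closed: "i \<in> T \<Longrightarrow> \<gamma> i \<in> mpolys T"
    and \<gamma>_ad: "i \<in> T \<Longrightarrow> f \<in> mpolys T \<Longrightarrow> (br (mpoly_var i) ^^ p) f = br (\<gamma> i) f"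
begin

sublocale A: poisson_algebra mpoly_scale "mpolys T" br by (rule poisson)

lemma p_prime': "prime p"
  using char_k p_gt_2 prime_CHAR_semidom[where ?'a = 'k] by simp

lemma p_zero': "(of_nat p :: ('i, 'k) mpol) = 0"
proof -
  have "(of_nat p :: 'k) = 0" using of_nat_CHAR[where ?'a = 'k] char_k by simp
  then have "Poly_Mapping.single 0 (of_nat p :: 'k) = (0 :: ('i, 'k) mpol)" by (simp only: single_zero)
  then show ?thesis by (simp only: single_of_nat)
qed

sublocale char_p p "TYPE(('i, 'k) mpol)"
  by unfold_locales (rule p_prime' p_zero')+

abbreviation x :: "'i \<Rightarrow> ('i, 'k) mpol" where "x \<equiv> mpoly_var"

lemmas closed = mpolys_const mpolys_var mpolys_add mpolys_mult A.br_closed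

lemma poisson_zero: "f \<in> mpolys T \<Longrightarrow> br 0 f = 0" "f \<in> mpolys T \<Longrightarrow> br f 0 = 0"
  using A.br_add_left[of 0 0 f] A.br_add_right[of f 0 0] mpolys_const[of 0 T] by auto

lemma poisson_skew:
  assumes "f \<in> mpolys T" "g \<in> mpolys T" shows "br f g = - br g f"
proof -
  have "br (f + g) (f + g) = 0" using assms by (intro A.br_self closed)
  then have "br f g + br g f = 0"
    using assms
    by (simp add: A.br_add_left A.br_add_right A.br_self[OF assms(1)] A.br_self[OF assms(2)] closed add.commute)
  then show ?thesis by (simp add: eq_neg_iff_add_eq_0)
qed

lemma br_const: "f \<in> mpolys T \<Longrightarrow> br (const c) f = 0" "f \<in> mpolys T \<Longrightarrow> br f (const c) = 0"
proof -
  assume f: "f \<in> mpolys T"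
  have "br (1 * 1) f = 1 * br 1 f + 1 * br 1 f" by (rule A.leibniz) (use f A.one_closed in auto)
  then have "br 1 f = 0" by simp
  then show "br (const c) f = 0"
    using A.br_scale_left[OF A.one_closed f, of c] by (simp add: mpoly_scale_def)
  then show "br f (const c) = 0" using poisson_skew[OF f mpolys_const[of c T]] by simp
qed

lemma leibniz_right:
  assumes "f \<in> mpolys T" "g \<in> mpolys T" "h \<in> mpolys T"
  shows "br h (f * g) = f * br h g + g * br h f"
  using A.leibniz[OF assms] poisson_skew[OF assms(3)] assms by (simp add: closed)

text \<open>
  The first-order jet \<open>df + f c\<close>, written in the basis of the jets of the variables, whence
  \<open>dx_i = jet x_i - x_i c\<close>; the index \<open>None\<close> stands for \<open>c = jet 1\<close>.
\<close>

definition jet :: "('i, 'k) mpol \<Rightarrow> ('i option \<Rightarrow>\<^sub>0 ('i, 'k) mpol)" where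
  "jet f = der fscale (\<lambda>i. unit_vec (Some i) - fscale (x i) (unit_vec None)) f + fscale f (unit_vec None)"

lemma jet_add: "jet (f + g) = jet f + jet g"
  by (simp add: jet_def der_add[OF module_fscale] fscale_simps)

lemma jet_mult: "jet (f * g) = fscale f (jet g) + fscale g (jet f) - fscale (f * g) (unit_vec None)"
  by (simp add: jet_def der_mult[OF module_fscale] fscale_simps mult.commute)

lemma jet_const: "jet (const c) = fscale (const c) (unit_vec None)"
  by (simp add: jet_def der_const[OF module_fscale])

lemma jet_var: "jet (x i) = unit_vec (Some i)"
  by (simp add: jet_def der_var[OF module_fscale])

lemma additive_jet: "additive jet"
  by (rule additive.intro) (rule jet_add)

lemma jet_zero: "jet 0 = 0" by (rule additive.zero[OF additive_jet])

lemma jet_minus: "jet (- f) = - jet f" by (rule additive.minus[OF additive_jet])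

lemma jet_const_mult: "jet (const c * f) = fscale (const c) (jet f)"
  by (simp add: jet_mult jet_const fscale_simps mult.commute)

text \<open>
  The forgetful map from jets to functions, a left inverse of \<open>jet\<close>.
\<close>

definition proj :: "('i option \<Rightarrow>\<^sub>0 ('i, 'k) mpol) \<Rightarrow> ('i, 'k) mpol" where
  "proj = linear_ext (*) (\<lambda>j. case j of None \<Rightarrow> 1 | Some i \<Rightarrow> x i)"

lemma proj_simps: "proj (u + v) = proj u + proj v" "proj (fscale a u) = a * proj u"
  "proj (u - v) = proj u - proj v" "proj (unit_vec None) = 1" "proj (unit_vec (Some i)) = x i"
  using additive.add[OF module.additive_linear_ext[OF module_mult]] additive.diff[OF module.additive_linear_ext[OF module_mult]]
  by (simp_all add: proj_def module.linear_ext_scale_fscale[OF module_mult] module.linear_ext_unit_vec[OF module_mult])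

lemma proj_jet: "proj (jet f) = f"
  using mpolys_UNIV[of f]
  by (induction f rule: mpolys_induct) (simp_all add: jet_const jet_var jet_add jet_mult proj_simps)

text \<open>
  The action \<open>{x_i, -}\<close> of the basis elements. The bracket is only known on polynomials in the variables
  from \<open>T\<close>; all other variables are treated as constants that have vanishing brackets, so that the
  action becomes defined on the whole ring.
\<close>

definition rho :: "'i option \<Rightarrow> ('i, 'k) mpol \<Rightarrow> ('i, 'k) mpol" where
  "rho j = (case j of None \<Rightarrow> (\<lambda>_. 0) | Some i \<Rightarrow>
     if i \<in> T then der (*) (\<lambda>l. if l \<in> T then br (x i) (x l) else 0) else (\<lambda>_. 0))"

definition struct :: "'i option \<Rightarrow> 'i option \<Rightarrow> ('i option \<Rightarrow>\<^sub>0 ('i, 'k) mpol)" where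
  "struct j l = (if j \<in> Some ` T \<and> l \<in> Some ` T then jet (br (x (the j)) (x (the l))) else 0)"

lemma rho_null: "j \<notin> Some ` T \<Longrightarrow> rho j g = 0"
  by (auto simp: rho_def split: option.split)

lemma rho_derivation: "derivation (rho j)"
  by (auto simp: rho_def derivation_def additive_def der_add[OF module_mult] der_mult[OF module_mult]
      split: option.split)

lemma rho_const: "rho j (const c) = 0"
  by (auto simp: rho_def der_const[OF module_mult] split: option.split)

lemma rho_var: "i \<in> T \<Longrightarrow> rho (Some i) (x l) = (if l \<in> T then br (x i) (x l) else 0)"
  by (simp add: rho_def der_var[OF module_mult])

lemma rho_eq:
  assumes "i \<in> T" "g \<in> mpolys T" shows "rho (Some i) g = br (x i) g"
  using assms(2)
  by (induction g rule: mpolys_induct)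
    (simp_all add: assms(1) rho_const rho_var br_const leibniz_right closed A.br_add_right
      derivationD(1,2)[OF rho_derivation])

lemma struct_null: "j \<notin> Some ` T \<Longrightarrow> struct j l = 0" "j \<notin> Some ` T \<Longrightarrow> struct l j = 0"
  by (simp_all add: struct_def)

sublocale J: lie_rinehart_presentation p rho struct
proof (rule lie_rinehart_presentation.intro)
  show "char_p TYPE(('i, 'k) mpol) p" by (rule char_p_axioms)
  show "2 < p" using p_gt_2 by simp
  show "derivation (rho j)" for j by (rule rho_derivation)
  show "struct i j = - struct j i" for i j
    using poisson_skew[of "x (the i)" "x (the j)"] by (auto simp: struct_def closed jet_minus)
qed

lemma anchor_const: "J.anchor u (const c) = 0"
  by (simp add: J.anchor_def linear_ext_def rho_const)

lemma anchor_jet: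
  assumes f: "f \<in> mpolys T" and g: "g \<in> mpolys T"
  shows "J.anchor (jet f) g = br f g"
  using f
  by (induction f rule: mpolys_induct)
    (simp_all add: jet_const jet_var jet_add jet_mult J.anchor_add J.anchor_scale J.anchor_diff rho_null rho_eq
      g br_const A.br_add_left A.leibniz)

lemma derivation_var_eqI:
  assumes D: "derivation D" "\<And>c. D (const c) = 0" and D': "derivation D'" "\<And>c. D' (const c) = 0"
    and eq: "\<And>l. D (x l) = D' (x l)"
  shows "D g = D' g"
  using mpolys_UNIV[of g]
  by (induction g rule: mpolys_induct)
    (simp_all add: assms(2,4) eq derivationD(1,2)[OF D(1)] derivationD(1,2)[OF D'(1)])

lemma derivation_commutator:
  assumes "derivation D" "derivation E"
  shows "derivation (\<lambda>g. D (E g) - E (D g))"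
  using assms by (auto simp: derivation_def additive_def algebra_simps)

lemma anchor_null:
  assumes "l \<notin> T" shows "J.anchor u (x l) = 0"
proof -
  have "rho j (x l) = 0" for j
    using assms rho_var[of "the j" l] rho_null[of j] by (cases "j \<in> Some ` T") auto
  then show ?thesis by (simp add: J.anchor_def linear_ext_def)
qed

text \<open>
  Both sides are derivations, so the variables suffice; there it is the Jacobi identity of the Poisson
  bracket.
\<close>

lemma anchor_struct: "J.anchor (struct i j) g = rho i (rho j g) - rho j (rho i g)"
proof (cases "i \<in> Some ` T \<and> j \<in> Some ` T")
  case False
  then show ?thesis
    using struct_null[of i j] struct_null[of j i] rho_null[of i] rho_null[of j] derivationD(3)[OF rho_derivation]
    by auto
next
  case True
  then obtain a b where ab: "i = Some a" "j = Some b" "a \<in> T" "b \<in> T" by auto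
  show ?thesis
  proof (rule derivation_var_eqI[OF J.anchor_derivation anchor_const derivation_commutator])
    show "rho i (rho j (const c)) - rho j (rho i (const c)) = 0" for c
      by (simp add: rho_const derivationD(3)[OF rho_derivation])
    fix l
    show "J.anchor (struct i j) (x l) = rho i (rho j (x l)) - rho j (rho i (x l))"
    proof (cases "l \<in> T")
      case True
      have "br (br (x a) (x b)) (x l) = br (x a) (br (x b) (x l)) - br (x b) (br (x a) (x l))"
        using A.jacobi[of "x a" "x b" "x l"] poisson_skew[of "x l" "br (x a) (x b)"]
          poisson_skew[of "x l" "x a"] ab True
          A.br_add_right[of "x b" "br (x a) (x l)" "- br (x a) (x l)"] poisson_zero(2)[of "x b"]
          A.br_scale_right[of "x b" "br (x a) (x l)" "-1"]
        by (simp add: closed mpoly_scale_def single_uminus algebra_simps)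
      then show ?thesis
        using True ab by (simp add: struct_def anchor_jet rho_var rho_eq closed)
    next
      case False
      then show ?thesis using ab by (simp add: anchor_null rho_var derivationD(3)[OF rho_derivation])
    qed
  qed (rule rho_derivation)+
qed

lemma bracket_null:
  assumes "j \<notin> Some ` T" shows "J.bracket (unit_vec j) u = 0" "J.bracket u (unit_vec j) = 0"
proof -
  show "J.bracket (unit_vec j) u = 0"
    by (rule free_module_induct[of "\<lambda>u. J.bracket (unit_vec j) u = 0"])
      (simp_all add: J.bracket_unit_vec struct_null[OF assms] J.bracket_scale J.bracket_add rho_null[OF assms] fscale_simps)
  then show "J.bracket u (unit_vec j) = 0" using J.bracket_skew[of u "unit_vec j"] by simp
qed

lemma bracket_diff: "J.bracket u (v - w) = J.bracket u v - J.bracket u w"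
  unfolding diff_conv_add_uminus J.bracket_add J.bracket_minus ..

text \<open>
  Both sides satisfy the same product rule in \<open>f\<close>.
\<close>

lemma bracket_unit_vec_jet:
  assumes i: "i \<in> T" and f: "f \<in> mpolys T"
  shows "J.bracket (unit_vec (Some i)) (jet f) = jet (br (x i) f)"
  using f
proof (induction f rule: mpolys_induct)
  case (const c)
  then show ?case using i
    by (simp add: jet_const J.bracket_scale rho_const bracket_null fscale_simps br_const closed jet_zero)
next
  case (var j)
  then show ?case using i unfolding jet_var J.bracket_unit_vec by (simp add: struct_def)
next
  case (add f g)
  then show ?case using i by (simp add: jet_add J.bracket_add A.br_add_right closed)
next
  case (mult f g)
  then show ?case using i
    by (simp add: jet_mult J.bracket_add bracket_diff J.bracket_scale rho_eq closed leibniz_right jet_add bracket_null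
        fscale_simps algebra_simps)
qed

text \<open>
  On jets of variables from \<open>T\<close> this is the jet of the Jacobi identity; all the other basis elements are
  central.
\<close>

lemma jacobiator_unit_vec: "J.jacobiator (unit_vec i) (unit_vec j) (unit_vec k) = 0"
proof -
  consider "i \<notin> Some ` T" | "j \<notin> Some ` T" | "k \<notin> Some ` T"
    | a b c where "i = Some a" "j = Some b" "k = Some c" "a \<in> T" "b \<in> T" "c \<in> T" by blast
  then show ?thesis
  proof cases
    case 4
    have J: "J.bracket (unit_vec (Some u)) (J.bracket (unit_vec (Some v)) (unit_vec (Some w))) = jet (br (x u) (br (x v) (x w)))"
      if "u \<in> T" "v \<in> T" "w \<in> T" for u v w
      using that by (simp add: J.bracket_unit_vec struct_def bracket_unit_vec_jet closed)
    have "J.jacobiator (unit_vec i) (unit_vec j) (unit_vec k) =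
        jet (br (x a) (br (x b) (x c)) + br (x b) (br (x c) (x a)) + br (x c) (br (x a) (x b)))"
      using 4 by (simp add: J.jacobiator_def J jet_add)
    also have "\<dots> = 0"
      using A.jacobi[of "x a" "x b" "x c"] 4 by (simp add: closed jet_zero)
    finally show ?thesis .
  qed (simp_all add: J.jacobiator_def bracket_null J.bracket_minus additive.zero[of "J.bracket _"] additive_def J.bracket_add)
qed

sublocale free_lie_rinehart p J.anchor J.bracket
  by (intro free_lie_rinehart.intro J.lie_rinehart_from_presentation anchor_struct jacobiator_unit_vec)

text \<open>
  The value \<open>0\<close> for \<open>c\<close> makes the p-map kill all multiples of \<open>c\<close>, in particular the term \<open>f^2 c\<close> of
  \<open>jet (f^2)\<close>. Variables outside \<open>T\<close> act by zero and may be sent to \<open>0\<close> too.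
\<close>

definition basis_pmap :: "'i option \<Rightarrow> ('i option \<Rightarrow>\<^sub>0 ('i, 'k) mpol)" where
  "basis_pmap j = (if j \<in> Some ` T then jet (\<gamma> (the j)) else 0)"

abbreviation "jet_pmap \<equiv> extended_pmap basis_pmap"

text \<open>
  By Leibniz's formula the p-th power of \<open>{x_i, -}\<close> is again a derivation, and so the assumption on
  \<open>\<gamma>\<close> has to be used on variables only.
\<close>

lemma anchor_unit_vec_funpow: "(J.anchor (unit_vec j) ^^ p) g = J.anchor (basis_pmap j) g"
proof -
  have r: "J.anchor (unit_vec j) = rho j" by (simp add: fun_eq_iff)
  have z: "rho j 0 = 0" by (rule derivationD(3)[OF rho_derivation])
  have c: "(rho j ^^ p) h = 0" if "rho j h = 0" for h
  proof -
    have "(rho j ^^ Suc n) h = 0" for n by (induction n) (simp_all add: that z)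
    then show ?thesis using p_Suc(1) by metis
  qed
  show ?thesis
  proof (cases "j \<in> Some ` T")
    case False
    then show ?thesis by (simp add: r c rho_null basis_pmap_def)
  next
    case True
    then obtain i where i: "j = Some i" "i \<in> T" by auto
    show ?thesis
      unfolding r
    proof (rule derivation_var_eqI[OF derivation_funpow_p[OF rho_derivation] _ J.anchor_derivation anchor_const])
      show "(rho j ^^ p) (const a) = 0" for a by (rule c) (rule rho_const)
      fix l
      show "(rho j ^^ p) (x l) = J.anchor (basis_pmap j) (x l)"
      proof (cases "l \<in> T")
        case False
        then show ?thesis using i c[of "x l"] by (simp add: rho_var anchor_null)
      next
        case True
        have "(rho j ^^ n) (x l) = (br (x i) ^^ n) (x l) \<and> (br (x i) ^^ n) (x l) \<in> mpolys T" for n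
          by (induction n) (simp_all add: i True closed rho_eq)
        then show ?thesis
          using i True by (simp add: \<gamma>_ad basis_pmap_def anchor_jet \<gamma>_closed closed)
      qed
    qed
  qed
qed

sublocale R: restricted_lie_rinehart fscale p J.anchor J.bracket jet_pmap
  by (rule restricted_lie_rinehart_extended_pmap) (rule anchor_unit_vec_funpow)

lemma bracket_jet:
  assumes f: "f \<in> mpolys T" and h: "h \<in> mpolys T"
  shows "J.bracket (jet h) (jet f) = jet (br h f)"
  using f
proof (induction f rule: mpolys_induct)
  case (const c)
  then show ?case using h
    by (simp add: jet_const J.bracket_scale anchor_const bracket_null fscale_simps br_const jet_zero)
next
  case (var i)
  have "J.bracket (unit_vec (Some i)) (jet h) = jet (br (x i) h)" by (rule bracket_unit_vec_jet) (use var h in auto)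
  then show ?case
    using J.bracket_skew[of "jet h" "unit_vec (Some i)"] poisson_skew[of h "x i"] var h
    by (simp add: jet_var jet_minus closed)
next
  case (add f g)
  then show ?case using h by (simp add: jet_add J.bracket_add A.br_add_right closed)
next
  case (mult f g)
  then show ?case using h
    by (simp add: jet_mult J.bracket_add bracket_diff J.bracket_scale anchor_jet closed leibniz_right jet_add bracket_null
        fscale_simps algebra_simps)
qed

lemma inv_nat_const:
  assumes "0 < i" "i < p"
  shows "(inv_nat i :: ('i, 'k) mpol) = const (1 / of_nat i)"
proof (rule inv_nat_unique[OF assms])
  have "(of_nat i :: 'k) \<noteq> 0"
    using assms char_k by (auto simp: of_nat_eq_0_iff_char_dvd dest: dvd_imp_le)
  moreover have "(of_nat i :: ('i, 'k) mpol) = const (of_nat i)" by (simp only: single_of_nat)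
  ultimately show "of_nat i * const (1 / of_nat i) = (1 :: ('i, 'k) mpol)"
    by (simp only: const_mult) simp
qed

lemma jet_Lambda:
  assumes "f \<in> mpolys T" "g \<in> mpolys T"
  shows "Lambda J.bracket (jet f) (jet g) = jet (jacobson_Lambda mpoly_scale br p f g)"
    "jacobson_Lambda mpoly_scale br p f g \<in> mpolys T"
proof -
  have s: "jacobson_s br p i f g \<in> mpolys T \<and> jet (jacobson_s br p i f g) = jacobson_s J.bracket p i (jet f) (jet g)" for i
    by (intro conjI jacobson_s_hom[where L = "mpolys T" and br' = J.bracket and \<phi> = jet] biadditive_br)
      (use mpolys_const[of 0 T] assms in \<open>simp_all add: closed poisson_zero jet_add bracket_jet\<close>)
  have "Lambda J.bracket (jet f) (jet g) = (\<Sum>i = 1..p - 1. jet (mpoly_scale (1 / of_nat i) (jacobson_s br p i f g)))"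
    unfolding Lambda_def
    by (intro sum.cong refl) (auto simp: s inv_nat_const mpoly_scale_def jet_const_mult)
  then show "Lambda J.bracket (jet f) (jet g) = jet (jacobson_Lambda mpoly_scale br p f g)"
    by (simp only: jacobson_Lambda_def additive.sum[OF additive_jet])
  show "jacobson_Lambda mpoly_scale br p f g \<in> mpolys T"
    unfolding jacobson_Lambda_def
    by (rule A.subspace_sum[OF A.carrier_subspace], rule A.subspace_scale[OF A.carrier_subspace]) (simp add: s)
qed

lemma jet_power: "jet (f ^ Suc n) = fscale (of_nat (Suc n) * f ^ n) (jet f) - fscale (of_nat n * f ^ Suc n) (unit_vec None)"
proof (induction n)
  case 0
  show ?case by (simp add: fscale_simps)
next
  case (Suc n)
  have gen: "fscale f (fscale a u - fscale b w) + fscale c u - fscale d w =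
      fscale (f * a + c) u - fscale (f * b + d) w" for a b c d u and w :: "'i option \<Rightarrow>\<^sub>0 ('i, 'k) mpol"
    by (simp add: fscale_simps)
  show ?case
    unfolding power_Suc[of f "Suc n"] jet_mult Suc.IH gen
    by (rule arg_cong2[of _ _ _ _ "\<lambda>a b. fscale a (jet f) - fscale b (unit_vec None)"])
      (simp_all add: algebra_simps)
qed

text \<open>
  The differential of a p-th power vanishes.
\<close>

lemma jet_power_p: "jet (f ^ p) = fscale (f ^ p) (unit_vec None)"
proof -
  have "jet (f ^ p) = fscale (of_nat p * f ^ (p - 1)) (jet f) - fscale (of_nat (p - 1) * f ^ p) (unit_vec None)"
    using jet_power[of f "p - 1"] p_Suc(1) by simp
  moreover have "of_nat (p - 1) = (- 1 :: ('i, 'k) mpol)"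
    using p_zero p_Suc(1) by (metis add.commute add_eq_0_iff of_nat_Suc)
  ultimately show ?thesis by (simp add: p_zero fscale_simps)
qed

lemma extended_pmap_scale_unit_vec_None: "jet_pmap (fscale f (unit_vec None)) = 0"
  by (simp add: extended_pmap_single basis_pmap_def fscale_simps hochschild_const rho_null image_iff)

lemma two_power: "(2 :: ('i, 'k) mpol) ^ p = 2"
  using freshman[of 1 1] by simp

lemma jet_square: "jet (f ^ 2) = fscale (2 * f) (jet f) + fscale (- (f ^ 2)) (unit_vec None)"
  by (simp only: power2_eq_square jet_mult mult_2 fscale_simps diff_conv_add_uminus)

text \<open>
  The rule for squares. In \<open>jet (f^2) = 2 f jet f - f^2 c\<close> the summands commute, and
  \<open>{f, 2 f} = 0\<close> removes the Hochschild term of \<open>2 f jet f\<close>.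
\<close>

lemma extended_pmap_jet_square:
  assumes f: "f \<in> mpolys T" and g: "jet_pmap (jet f) = jet g"
  shows "jet_pmap (jet (f ^ 2)) = jet (2 * f ^ p * g)"
proof -
  have ff: "br f f = 0" by (rule A.br_self[OF f])
  have two: "(2 :: ('i, 'k) mpol) = const 2" by simp
  have 1: "J.anchor (jet f) (2 * f) = 0"
    unfolding two using f ff
    by (simp add: anchor_jet closed leibniz_right br_const del: single_numeral)
  have "J.anchor (fscale (2 * f) (jet f)) (- (f ^ 2)) = 0"
    using f ff by (simp add: J.anchor_scale anchor_jet closed leibniz_right power2_eq_square
        additive.minus[OF derivationD(5)[OF J.anchor_derivation]])
  then have "J.bracket (fscale (2 * f) (jet f)) (fscale (- (f ^ 2)) (unit_vec None)) = 0"
    by (simp only: J.bracket_scale) (simp add: bracket_null fscale_simps)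
  then have "Lambda J.bracket (fscale (2 * f) (jet f)) (fscale (- (f ^ 2)) (unit_vec None)) = 0"
    by (rule Lambda_commuting)
  then have "jet_pmap (jet (f ^ 2)) = jet_pmap (fscale (2 * f) (jet f))"
    unfolding jet_square extended_pmap_add extended_pmap_scale_unit_vec_None by simp
  also have "\<dots> = fscale (2 * f ^ p) (jet g)"
    by (simp add: extended_pmap_scale g hochschild_const[OF 1] power_mult_distrib two_power)
  also have "\<dots> = jet (2 * f ^ p * g)"
  proof -
    have "jet (2 * f ^ p) = fscale (2 * f ^ p) (unit_vec None)"
      unfolding two by (simp add: jet_const_mult jet_power_p fscale_simps del: single_numeral)
    then show ?thesis by (simp add: jet_mult fscale_simps mult_ac)
  qed
  finally show ?thesis .
qed

lemma extended_pmap_jet_add: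
  assumes "f \<in> mpolys T" "g \<in> mpolys T" "jet_pmap (jet f) = jet f'" "jet_pmap (jet g) = jet g'"
  shows "jet_pmap (jet (f + g)) = jet (f' + g' + jacobson_Lambda mpoly_scale br p f g)"
  using assms by (simp add: jet_add extended_pmap_add jet_Lambda)

lemma extended_pmap_jet_const_mult:
  assumes "jet_pmap (jet f) = jet f'"
  shows "jet_pmap (jet (const c * f)) = jet (const (c ^ p) * f')"
  using assms by (simp add: jet_const_mult extended_pmap_scale hochschild_const anchor_const const_power)

text \<open>
  The polynomials whose jets are sent to jets are closed under sums, scalars and squares, hence under
  products.
\<close>

lemma extended_pmap_jet:
  assumes "f \<in> mpolys T"
  shows "\<exists>g \<in> mpolys T. jet_pmap (jet f) = jet g"
  using assms
proof (induction f rule: mpolys_induct)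
  case (const c)
  show ?case
    by (rule bexI[of _ 0]) (use mpolys_const[of 0 T] in \<open>simp_all add: jet_const extended_pmap_scale_unit_vec_None jet_zero\<close>)
next
  case (var i)
  then show ?case
    by (intro bexI[of _ "\<gamma> i"]) (simp_all add: jet_var extended_pmap_unit_vec basis_pmap_def \<gamma>_closed)
next
  case (add f g)
  then show ?case by (metis extended_pmap_jet_add jet_Lambda(2) mpolys_add)
next
  case (mult f g)
  let ?G = "\<lambda>f. f \<in> mpolys T \<and> (\<exists>g \<in> mpolys T. jet_pmap (jet f) = jet g)"
  have two: "const 2 \<in> (mpolys T :: ('i, 'k) mpol set)" by (rule mpolys_const)
  have G_add: "?G (f + g)" if "?G f" "?G g" for f g
    using that by (metis extended_pmap_jet_add jet_Lambda(2) mpolys_add)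
  have G_scale: "?G (const c * f)" if "?G f" for f c
    using that by (metis extended_pmap_jet_const_mult mpolys_const mpolys_mult)
  have G_square: "?G (f ^ 2)" if "?G f" for f
  proof -
    from that obtain g where g: "g \<in> mpolys T" "jet_pmap (jet f) = jet g" by blast
    have "f ^ n \<in> mpolys T" for n
      using that A.one_closed by (induction n) (simp_all add: closed)
    then have "f ^ 2 \<in> mpolys T" "2 * f ^ p * g \<in> mpolys T"
      using g two by (auto intro!: mpolys_mult)
    then show ?thesis using extended_pmap_jet_square[OF _ g(2)] that by blast
  qed
  \<comment> \<open>Polarization; this needs the characteristic to be odd.\<close>
  have eq: "f * g = const (1 / 2) * ((f + g) ^ 2 + const (- 1) * (f ^ 2 + g ^ 2))"
  proof -
    have "(2 :: 'k) \<noteq> 0"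
      using char_k p_gt_2 of_nat_eq_0_iff_char_dvd[where ?'a = 'k, of 2] by (auto dest: dvd_imp_le)
    then have "const (1 / 2) * (2 :: ('i, 'k) mpol) = 1"
      using const_mult[of "1 / 2" "2 :: 'k"] by simp
    moreover have "(f + g) ^ 2 + const (- 1) * (f ^ 2 + g ^ 2) = 2 * (f * g)"
      by (simp add: single_uminus power2_eq_square algebra_simps)
    ultimately show ?thesis by (simp only: mult.assoc[symmetric] mult_1)
  qed
  have "?G f" "?G g" using mult by auto
  then have "?G (const (1 / 2) * ((f + g) ^ 2 + const (- 1) * (f ^ 2 + g ^ 2)))"
    by (intro G_add G_square G_scale)
  then show ?case unfolding eq by (rule conjunct2)
qed

definition pmap :: "('i, 'k) mpol \<Rightarrow> ('i, 'k) mpol" where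
  "pmap f = proj (jet_pmap (jet f))"

lemma pmap:
  assumes "f \<in> mpolys T"
  shows "pmap f \<in> mpolys T" "jet_pmap (jet f) = jet (pmap f)"
  using extended_pmap_jet[OF assms] by (auto simp: pmap_def proj_jet)

lemma pmap_eqI: "jet_pmap (jet f) = jet g \<Longrightarrow> pmap f = g"
  by (simp add: pmap_def proj_jet)

theorem restricted_poisson: "restricted_poisson_algebra mpoly_scale (mpolys T) br p pmap"
proof (intro restricted_poisson_algebra.intro restricted_lie_algebra.intro poisson
    A.lie_algebra_axioms restricted_lie_algebra_axioms.intro restricted_poisson_algebra_axioms.intro)
  show "CHAR('k) = p" "3 \<le> p" by (rule char_k p_gt_2)+
  fix f :: "('i, 'k) mpol" assume f: "f \<in> mpolys T"
  show "pmap f \<in> mpolys T" by (rule pmap(1)[OF f])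
  show "pmap (mpoly_scale c f) = mpoly_scale (c ^ p) (pmap f)" for c
    unfolding mpoly_scale_def by (rule pmap_eqI, rule extended_pmap_jet_const_mult, rule pmap(2)[OF f])
  show "pmap (f ^ 2) = 2 * f ^ p * pmap f"
    by (rule pmap_eqI, rule extended_pmap_jet_square[OF f], rule pmap(2)[OF f])
  fix g :: "('i, 'k) mpol" assume g: "g \<in> mpolys T"
  show "pmap (f + g) = pmap f + pmap g + jacobson_Lambda mpoly_scale br p f g"
    by (rule pmap_eqI, rule extended_pmap_jet_add) (simp_all add: f g pmap)
  have "(br f ^^ n) g \<in> mpolys T \<and> (br f ^^ n) g = (J.anchor (jet f) ^^ n) g" for n
    by (induction n) (auto simp: f g closed anchor_jet)
  then have "(br f ^^ p) g = J.anchor (jet_pmap (jet f)) g"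
    using R.P_act by simp
  then show "(br f ^^ p) g = br (pmap f) g"
    by (simp add: pmap f g anchor_jet)
qed

lemma pmap_var: "i \<in> T \<Longrightarrow> pmap (x i) = \<gamma> i"
  by (rule pmap_eqI) (simp add: jet_var extended_pmap_unit_vec basis_pmap_def)

end

theorem theorem0p3:
  fixes T :: "'i set"
    and br :: "('i, 'k::field) mpol \<Rightarrow> ('i, 'k) mpol \<Rightarrow> ('i, 'k) mpol"
    and \<gamma> :: "'i \<Rightarrow> ('i, 'k) mpol"
    and p :: nat
  assumes "CHAR('k) = p" and "p \<ge> 3"
    and "poisson_algebra mpoly_scale (mpolys T) br"
    and "\<And>i. i \<in> T \<Longrightarrow> \<gamma> i \<in> mpolys T"
    and "\<And>i f. i \<in> T \<Longrightarrow> f \<in> mpolys T \<Longrightarrow> (br (mpoly_var i) ^^ p) f = br (\<gamma> i) f"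
  shows "\<exists>pmap. restricted_poisson_algebra mpoly_scale (mpolys T) br p pmap \<and>
           (\<forall>i\<in>T. pmap (mpoly_var i) = \<gamma> i)"
proof -
  interpret poisson_polynomials T br \<gamma> p
    by (intro poisson_polynomials.intro assms)
  show ?thesis using restricted_poisson pmap_var by blast
qed

end
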